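(* Fix $x\in\mathbb R$. The solution to the potential mean-field game associated with the mean-field monotone follower problem is unique: if $(\xi^1,\theta^1)$ and $(\xi^2,\theta^2)$ are two solutions, then $\xi^1=\xi^2$ (up to indistinguishability) and $\theta^1=\theta^2$.
   Context: $T>0$, $\sigma>0$, $\rho>0$, $K>0$, $\alpha\in\mathbb R$ are constants; $(\Omega,\mathcal F,\mathbb F,\mathbb P)$ is a complete filtered probability space satisfying the usual conditions with a one-dimensional $\mathbb F$-Brownian motion $W$. $\mathcal B$ is the set of real-valued $\mathbb F$-adapted, non-decreasing, càdlàg processes $\xi=(\xi_t)_{t\in[0,T]}$ with $\xi_{0-}=0$ a.s. and $\mathbb E[\xi_T^2]<\infty$; integrals $\int_0^T\cdot\,d\xi_t$ are over $[0,T]$ including jumps at $0$ and $T$. For $\xi\in\mathcal B$, $X^\xi_t=x+\sigma W_t-\xi_t$. The mean-field monotone follower problem is to minimize over $\xi\in\mathcal B$ the functional $J(\xi)=\mathbb E\big[\frac12\int_0^Te^{-\rho t}(X^\xi_t-\alpha\mathbb E[X^\xi_t])^2dt+K\int_0^Te^{-\rho t}d\xi_t\big]$. The associated potential mean-field game has cost, for a measurable function $\theta:[0,T]\to\mathbb R$, $$J_g(\xi,\theta)=\mathbb E\Big[\int_0^Te^{-\rho t}\Big(\tfrac12(X^\xi_t-\alpha\theta_t)^2-\alpha(1-\alpha)\theta_tX^\xi_t\Big)dt+K\int_0^Te^{-\rho t}d\xi_t\Big].$$ A *solution to the potential mean-field game* is a pair $(\xi^*,\theta^* )$, with $\xi^*\in\mathcal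 B$ and $\theta^*:[0,T]\to\mathbb R$ measurable, such that (i) $J_g(\xi^*,\theta^* )\le J_g(\xi,\theta^* )$ for all $\xi\in\mathcal B$, and (ii) $\theta^*_t=\mathbb E[X^{\xi^*}_t]$ for all $t\in[0,T]$. *)

theory Defs
  imports "HOL-Probability.Probability"
begin

text \<open>
  The time index of all processes is \<^typ>\<open>real\<close>, but only times in \<open>{0..T}\<close> are ever constrained.
  Completeness of the probability space and of \<open>F 0\<close> (hence of every \<open>F t\<close>) together with
  right-continuity of the filtration are the usual conditions.
\<close>

locale usual_filtered_prob_space = prob_space M + complete_measure M
  for M :: "'a measure" and F :: "real \<Rightarrow> 'a measure" and T :: real +
  assumes subalgebra_F: "t \<in> {0..T} \<Longrightarrow> subalgebra M (F t)"
    and F_mono: "0 \<le> s \<Longrightarrow> s \<le> t \<Longrightarrow> t \<le> T \<Longrightarrow> subalgebra (F t) (F s)"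
    and F_right_cont: "0 \<le> t \<Longrightarrow> t < T \<Longrightarrow> (\<Inter>s\<in>{t<..T}. sets (F s)) \<subseteq> sets (F t)"
    and F_complete: "null_sets M \<subseteq> sets (F 0)"

locale brownian_filtered_space = usual_filtered_prob_space M F T
  for M :: "'a measure" and F :: "real \<Rightarrow> 'a measure" and T :: real +
  fixes W :: "real \<Rightarrow> 'a \<Rightarrow> real"
  assumes W_adapted: "t \<in> {0..T} \<Longrightarrow> W t \<in> borel_measurable (F t)"
    and W_0: "AE \<omega> in M. W 0 \<omega> = 0"
    and W_cont: "AE \<omega> in M. continuous_on {0..T} (\<lambda>t. W t \<omega>)"
    and W_normal: "0 \<le> s \<Longrightarrow> s < t \<Longrightarrow> t \<le> T \<Longrightarrow>
      distributed M lborel (\<lambda>\<omega>. W t \<omega> - W s \<omega>) (normal_density 0 (sqrt (t - s)))"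
    and W_indep: "0 \<le> s \<Longrightarrow> s < t \<Longrightarrow> t \<le> T \<Longrightarrow>
      indep_set (sets (F s)) (sets (vimage_algebra (space M) (\<lambda>\<omega>. W t \<omega> - W s \<omega>) borel))"

definition cadlag_on :: "real \<Rightarrow> (real \<Rightarrow> real) \<Rightarrow> bool" where
  "cadlag_on T f \<longleftrightarrow>
     (\<forall>t\<in>{0..<T}. (f \<longlongrightarrow> f t) (at_right t)) \<and> (\<forall>t\<in>{0<..T}. \<exists>l. (f \<longlongrightarrow> l) (at_left t))"

text \<open>
  The set \<open>\<B>\<close>. Path properties are required almost surely. The value \<open>\<xi>\<^sub>0\<^sub>-\<close> is \<open>0\<close> by convention
  (see \<open>ext_path\<close>), so monotonicity across time \<open>0\<close> amounts to \<open>0 \<le> \<xi> 0\<close>; a jump at \<open>0\<close> is allowed.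
\<close>

definition monotone_controls ::
  "'a measure \<Rightarrow> (real \<Rightarrow> 'a measure) \<Rightarrow> real \<Rightarrow> (real \<Rightarrow> 'a \<Rightarrow> real) set" where
  "monotone_controls M F T = {\<xi>.
     (\<forall>t\<in>{0..T}. \<xi> t \<in> borel_measurable (F t)) \<and>
     (AE \<omega> in M. 0 \<le> \<xi> 0 \<omega> \<and> mono_on {0..T} (\<lambda>t. \<xi> t \<omega>) \<and> cadlag_on T (\<lambda>t. \<xi> t \<omega>)) \<and>
     integrable M (\<lambda>\<omega>. (\<xi> T \<omega>)\<^sup>2)}"

text \<open>
  A path on \<open>[0,T]\<close> extended by \<open>0\<close> to the left and by its value at \<open>T\<close> to the right. For a path of a
  control the extension is non-decreasing and right-continuous on the whole line, so
  \<^const>\<open>interval_measure\<close> yields its Stieltjes measure. That measure has mass \<open>f 0\<close> at time \<open>0\<close> (the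
  initial jump) and mass \<open>f T - f (T-)\<close> at \<open>T\<close>.
\<close>

definition ext_path :: "real \<Rightarrow> (real \<Rightarrow> real) \<Rightarrow> real \<Rightarrow> real" where
  "ext_path T f t = (if t < 0 then 0 else f (min t T))"

definition stieltjes_integral :: "real \<Rightarrow> (real \<Rightarrow> real) \<Rightarrow> (real \<Rightarrow> real) \<Rightarrow> real" where
  "stieltjes_integral T g f = (LINT t:{0..T}|interval_measure (ext_path T f). g t)"

definition controlled_state ::
  "real \<Rightarrow> real \<Rightarrow> (real \<Rightarrow> 'a \<Rightarrow> real) \<Rightarrow> (real \<Rightarrow> 'a \<Rightarrow> real) \<Rightarrow> real \<Rightarrow> 'a \<Rightarrow> real" where
  "controlled_state x \<sigma> W \<xi> t \<omega> = x + \<sigma> * W t \<omega> - \<xi> t \<omega>"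

definition mfg_cost ::
  "'a measure \<Rightarrow> real \<Rightarrow> (real \<Rightarrow> 'a \<Rightarrow> real) \<Rightarrow> real \<Rightarrow> real \<Rightarrow> real \<Rightarrow> real \<Rightarrow> real \<Rightarrow>
   (real \<Rightarrow> 'a \<Rightarrow> real) \<Rightarrow> (real \<Rightarrow> real) \<Rightarrow> real" where
  "mfg_cost M T W \<sigma> \<rho> K \<alpha> x \<xi> \<theta> =
     (LINT \<omega>|M.
        (LINT t:{0..T}|lborel. exp (- \<rho> * t) *
            (1 / 2 * (controlled_state x \<sigma> W \<xi> t \<omega> - \<alpha> * \<theta> t)\<^sup>2
             - \<alpha> * (1 - \<alpha>) * \<theta> t * controlled_state x \<sigma> W \<xi> t \<omega>))
        + K * stieltjes_integral T (\<lambda>t. exp (- \<rho> * t)) (\<lambda>t. \<xi> t \<omega>))"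

definition mfg_solution ::
  "'a measure \<Rightarrow> (real \<Rightarrow> 'a measure) \<Rightarrow> real \<Rightarrow> (real \<Rightarrow> 'a \<Rightarrow> real) \<Rightarrow>
   real \<Rightarrow> real \<Rightarrow> real \<Rightarrow> real \<Rightarrow> real \<Rightarrow> (real \<Rightarrow> 'a \<Rightarrow> real) \<Rightarrow> (real \<Rightarrow> real) \<Rightarrow> bool" where
  "mfg_solution M F T W \<sigma> \<rho> K \<alpha> x \<xi> \<theta> \<longleftrightarrow>
     \<xi> \<in> monotone_controls M F T \<and>
     \<theta> \<in> borel_measurable (restrict_space borel {0..T}) \<and>
     (\<forall>\<eta>\<in>monotone_controls M F T.
        mfg_cost M T W \<sigma> \<rho> K \<alpha> x \<xi> \<theta> \<le> mfg_cost M T W \<sigma> \<rho> K \<alpha> x \<eta> \<theta>) \<and>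
     (\<forall>t\<in>{0..T}. \<theta> t = (LINT \<omega>|M. controlled_state x \<sigma> W \<xi> t \<omega>))"

end

theory Submission
  imports Defs
begin

text \<open>
  Integrating the Stieltjes term by parts makes the cost a quadratic functional of the control, so a
  solution satisfies a variational inequality in every admissible direction. Adding the inequalities
  of two solutions, each tested against the other, shows that the gap \<open>\<xi>2 - \<xi>1\<close> equals its mean \<open>m\<close>
  and that \<open>(1 - \<alpha>)\<^sup>2 m\<^sup>2 = 0\<close> for almost every time; this settles \<open>\<alpha> \<noteq> 1\<close>. For \<open>\<alpha> = 1\<close> a
  deterministic gap is invisible to the running cost. There each control is stationary in the
  direction of its own path stopped at an arbitrary time \<open>b\<close>, and subtracting the two stationarity
  conditions leaves \<open>\<integral>\<^bsub>[0,b]\<^esub> exp (- \<rho> t) dm = 0\<close> for all \<open>b\<close>, whence \<open>m = 0\<close>.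
  A solution has no jump at \<open>T\<close>, since such a jump is costly but does not affect the running cost.
\<close>

section \<open>Discounted time and Stieltjes integration by parts\<close>

text \<open>The obstacle is that a control may only increase, so a generic direction yields an
  inequality and no equation. For two solutions tested against each other this suffices: a function
  of time integrated against the gap sees only its mean, and the remaining coefficient of the
  squared mean, 1 - \<alpha>(2 - \<alpha>), is a square. If \<alpha> = 1 that coefficient is zero
  and an equation is needed. The control stopped at b supplies it, because adding it to the control
  and subtracting it both preserve monotonicity. In the difference of the two equations the common
  centred state is paired with a deterministic function, the gap stopped at b; the centred state has
  mean zero, so this pairing vanishes and only the cost of control is left. The quadratic argument
  fixes the gap at almost every time only. Right-continuity extends this to every time before T but
  gives nothing at T, which has no right neighbourhood and is a null set for the running cost. This
  is why the jump at T is excluded by a separate argument.\<close>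

definition discounted_time :: "real \<Rightarrow> real \<Rightarrow> real measure" where
  "discounted_time T \<rho> = density (restrict_space lborel {0..T}) (\<lambda>t. ennreal (exp (- \<rho> * t)))"

lemma space_discounted_time [simp]: "space (discounted_time T \<rho>) = {0..T}"
  by (simp add: discounted_time_def)

lemma sets_discounted_time [measurable_cong]:
  "sets (discounted_time T \<rho>) = sets (restrict_space borel {0..T})"
  by (simp add: discounted_time_def sets_restrict_space)

lemma finite_measure_discounted_time:
  assumes "\<rho> > 0" shows "finite_measure (discounted_time T \<rho>)"
proof
  have m: "(\<lambda>t. ennreal (exp (- \<rho> * t))) \<in> borel_measurable (restrict_space lborel {0..T})"
    by (intro measurable_restrict_space1) auto
  have "emeasure (discounted_time T \<rho>) (space (discounted_time T \<rho>))
      = (\<integral>\<^sup>+t. ennreal (exp (- \<rho> * t)) \<partial>restrict_space lborel {0..T})"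
    unfolding discounted_time_def using m
    by (subst emeasure_density) (auto simp: sets_restrict_space intro!: nn_integral_cong)
  also have "\<dots> \<le> (\<integral>\<^sup>+t. 1 \<partial>restrict_space lborel {0..T})"
    using assms by (intro nn_integral_mono) (auto simp flip: ennreal_1)
  also have "\<dots> = emeasure lborel {0..T}"
    by (simp add: emeasure_restrict_space)
  also have "\<dots> < \<infinity>" using emeasure_lborel_Icc_eq[of 0 T] by (auto split: if_splits)
  finally show "emeasure (discounted_time T \<rho>) (space (discounted_time T \<rho>)) \<noteq> \<infinity>"
    by auto
qed

text \<open>The base space is [0,T] itself, since a mean-field function is required to be measurable
  only there. This equation leads back to the set integral in \<open>mfg_cost\<close>.\<close>

lemma integral_discounted_time:
  fixes f :: "real \<Rightarrow> real"
  assumes "f \<in> borel_measurable (restrict_space borel {0..T})"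
  shows "(LINT t:{0..T}|lborel. exp (- \<rho> * t) * f t) = integral\<^sup>L (discounted_time T \<rho>) f"
proof -
  have "f \<in> borel_measurable (restrict_space lborel {0..T})"
    using assms by (simp cong: measurable_cong_sets add: sets_restrict_space)
  moreover have "(\<lambda>t. exp (- \<rho> * t)) \<in> borel_measurable (restrict_space lborel {0..T})"
    by (intro measurable_restrict_space1) auto
  ultimately have "integral\<^sup>L (discounted_time T \<rho>) f
      = (LINT t|restrict_space lborel {0..T}. exp (- \<rho> * t) * f t)"
    unfolding discounted_time_def by (subst integral_density) auto
  then show ?thesis
    by (simp add: integral_restrict_space set_lebesgue_integral_def)
qed

lemma integrable_discounted_time:
  fixes f :: "real \<Rightarrow> real"
  assumes "integrable (discounted_time T \<rho>) f"
  shows "set_integrable lborel {0..T} (\<lambda>t. exp (- \<rho> * t) * f t)"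
proof -
  have "f \<in> borel_measurable (restrict_space lborel {0..T})"
    using assms by (auto simp: discounted_time_def)
  moreover have "(\<lambda>t. exp (- \<rho> * t)) \<in> borel_measurable (restrict_space lborel {0..T})"
    by (intro measurable_restrict_space1) auto
  ultimately have "integrable (restrict_space lborel {0..T}) (\<lambda>t. exp (- \<rho> * t) * f t)"
    using assms unfolding discounted_time_def by (subst (asm) integrable_density) auto
  then show ?thesis
    by (simp add: integrable_restrict_space set_integrable_def)
qed

text \<open>The density is strictly positive, so discounting leaves the null sets of Lebesgue
  measure unchanged.\<close>

lemma AE_discounted_time:
  "(AE t in discounted_time T \<rho>. P t) \<longleftrightarrow> (AE t in lborel. t \<in> {0..T} \<longrightarrow> P t)"
proof -
  have "(\<lambda>t. ennreal (exp (- \<rho> * t))) \<in> borel_measurable (restrict_space lborel {0..T})"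
    by (intro measurable_restrict_space1) auto
  then show ?thesis unfolding discounted_time_def
    by (subst AE_density) (auto simp: AE_restrict_space_iff)
qed

text \<open>The mass of half-open intervals is known, so the negative half-line is covered by
  countably many of them that stay away from 0, where a possible atom sits. On each of them
  \<open>G\<close> is constantly 0.\<close>

lemma null_sets_interval_measure_lessThan_zero:
  assumes mono: "\<And>x y. x \<le> y \<Longrightarrow> G x \<le> G y" and rc: "\<And>a. continuous (at_right a) G"
    and zero: "\<And>t. t < 0 \<Longrightarrow> G t = 0"
  shows "{..<0} \<in> null_sets (interval_measure G)"
proof -
  have "(\<Union>n::nat. {- real n - 1 <.. - 1 / (real n + 1)}) \<in> null_sets (interval_measure G)"
  proof (rule null_sets_UN, intro null_setsI)
    fix n :: nat
    have "- real n - 1 \<le> - 1 / (real n + 1)"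
      by (simp add: field_simps)
    then show "emeasure (interval_measure G) {- real n - 1 <.. - 1 / (real n + 1)} = 0"
      using zero[of "- real n - 1"] zero[of "- 1 / (real n + 1)"]
      by (subst emeasure_interval_measure_Ioc[OF _ mono rc]) (auto simp: field_simps)
  qed auto
  moreover have "{..<0} \<subseteq> (\<Union>n::nat. {- real n - 1 <.. - 1 / (real n + 1)})"
  proof
    fix t :: real assume "t \<in> {..<0}"
    obtain n :: nat where n: "max (- t) (1 / (- t)) < real n" using reals_Archimedean2 by blast
    then have "- t < real n + 1" "1 / (- t) < real n + 1" by auto
    then have "- real n - 1 < t" "t \<le> - 1 / (real n + 1)"
      using \<open>t \<in> {..<0}\<close> by (auto simp: field_simps)
    then show "t \<in> (\<Union>n::nat. {- real n - 1 <.. - 1 / (real n + 1)})" by auto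
  qed
  ultimately show ?thesis by (auto intro: null_sets_subset)
qed

lemma ext_path_mono:
  assumes "T > 0" "mono_on {0..T} f" "0 \<le> f 0" "s \<le> t"
  shows "ext_path T f s \<le> ext_path T f t"
proof -
  have "0 \<le> f u" if "u \<in> {0..T}" for u
    using mono_onD[OF assms(2), of 0 u] that assms by auto
  then show ?thesis
    using assms mono_onD[OF assms(2), of "min s T" "min t T"]
    by (auto simp: ext_path_def)
qed

lemma ext_path_right_cont:
  assumes "T > 0" "\<forall>t\<in>{0..<T}. (f \<longlongrightarrow> f t) (at_right t)"
  shows "continuous (at_right a) (ext_path T f)"
proof -
  consider "a < 0" | "0 \<le> a" "a < T" | "T \<le> a" by linarith
  then show ?thesis
  proof cases
    case 1
    have "\<forall>\<^sub>F t in at_right a. ext_path T f t = 0"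
      by (rule eventually_at_rightI[of a 0]) (use 1 in \<open>auto simp: ext_path_def\<close>)
    then show ?thesis using 1
      by (simp add: continuous_within ext_path_def tendsto_eventually)
  next
    case 2
    have "\<forall>\<^sub>F t in at_right a. f t = ext_path T f t"
      by (rule eventually_at_rightI[of a T]) (use 2 in \<open>auto simp: ext_path_def\<close>)
    from Lim_transform_eventually[OF _ this, of "f a"] show ?thesis
      using 2 assms(2) by (simp add: continuous_within) (simp add: ext_path_def)
  next
    case 3
    have "\<forall>\<^sub>F t in at_right a. ext_path T f t = f T"
      by (rule eventually_at_rightI[of a "a+1"]) (use 3 assms in \<open>auto simp: ext_path_def\<close>)
    then show ?thesis using 3 assms
      by (simp add: continuous_within ext_path_def tendsto_eventually)
  qed
qed

text \<open>The discount at \<open>a\<close> is the terminal discount plus a tail integral. In this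
  form Fubini can perform the integration by parts, and the same identity later absorbs the terminal
  term in the integral equation for the gap.\<close>

lemma integral_discounted_tail:
  assumes "\<rho> > 0" "0 \<le> a" "a \<le> T"
  shows "\<rho> * (\<integral>s. indicator {a..T} s \<partial>discounted_time T \<rho>) = exp (- \<rho> * a) - exp (- \<rho> * T)"
proof -
  have "((\<lambda>s. exp (- \<rho> * s)) has_integral
      (- exp (- \<rho> * T) / \<rho> - (- exp (- \<rho> * a) / \<rho>))) {a..T}"
    using assms
    by (intro fundamental_theorem_of_calculus)
       (auto intro!: derivative_eq_intros simp flip: has_real_derivative_iff_has_vector_derivative)
  moreover have "set_integrable lborel {a..T} (\<lambda>s. exp (- \<rho> * s))"
    by (intro borel_integrable_atLeastAtMost') (auto intro!: continuous_intros)
  ultimately have "(LINT s:{a..T}|lborel. exp (- \<rho> * s))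
      = - exp (- \<rho> * T) / \<rho> - (- exp (- \<rho> * a) / \<rho>)"
    by (metis set_borel_integral_eq_integral(2) integral_unique)
  moreover have "(LINT s:{0..T}|lborel. exp (- \<rho> * s) * indicator {a..T} s)
      = (LINT s:{a..T}|lborel. exp (- \<rho> * s))"
    unfolding set_lebesgue_integral_def
    using assms by (intro Bochner_Integration.integral_cong) (auto simp: indicator_def)
  ultimately show ?thesis
    using assms by (subst integral_discounted_time[symmetric])
      (auto simp: field_simps intro!: measurable_restrict_space1)
qed

text \<open>Each discount factor is written as an integral over later times, and Fubini is applied
  to the indicator of t \<le> s. The inner mass of [0,s] is \<open>f s\<close>, initial jump
  included. The path then enters linearly, which makes the cost easy to perturb.\<close>

lemma stieltjes_integral_by_parts:
  assumes "T > 0" "\<rho> > 0" "mono_on {0..T} f" "0 \<le> f 0"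
    and rc: "\<forall>t\<in>{0..<T}. (f \<longlongrightarrow> f t) (at_right t)"
  shows "stieltjes_integral T (\<lambda>t. exp (- \<rho> * t)) f
    = exp (- \<rho> * T) * f T + \<rho> * (\<integral>t. f t \<partial>discounted_time T \<rho>)"
proof -
  define G where "G = ext_path T f"
  have mono: "\<And>s t. s \<le> t \<Longrightarrow> G s \<le> G t" and cont: "\<And>a. continuous (at_right a) G"
    using assms ext_path_mono ext_path_right_cont unfolding G_def by auto
  define \<mu> where "\<mu> = restrict_space (interval_measure G) {0..T}"
  have null: "{..<0} \<in> null_sets (interval_measure G)"
    by (rule null_sets_interval_measure_lessThan_zero[OF mono cont]) (auto simp: G_def ext_path_def)
  \<comment> \<open>Starting from -1, where the extended path is 0, counts the atom at 0: the mass
    is \<open>f s\<close> and not \<open>f s - f 0\<close>.\<close>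
  have Icc: "emeasure (interval_measure G) {0..s} = f s" if "s \<in> {0..T}" for s
  proof -
    have "emeasure (interval_measure G) {0..s}
        = emeasure (interval_measure G) ({-1<..s} - {..<0})"
      using that by (intro arg_cong[where f="emeasure _"]) auto
    also have "\<dots> = emeasure (interval_measure G) {-1<..s}"
      by (rule emeasure_Diff_null_set[OF null]) auto
    also have "\<dots> = f s"
      using that by (subst emeasure_interval_measure_Ioc[OF _ mono cont]) (auto simp: G_def ext_path_def)
    finally show ?thesis .
  qed
  have f_nonneg: "0 \<le> f s" if "s \<in> {0..T}" for s
    using mono_onD[OF assms(3), of 0 s] that assms by auto
  interpret \<mu>: finite_measure \<mu>
    by standard (use Icc[of T] assms in \<open>auto simp: \<mu>_def emeasure_restrict_space space_restrict_space\<close>)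
  interpret D: finite_measure "discounted_time T \<rho>"
    by (rule finite_measure_discounted_time[OF assms(2)])
  interpret P: pair_sigma_finite \<mu> "discounted_time T \<rho>" ..
  interpret P': finite_measure "\<mu> \<Otimes>\<^sub>M discounted_time T \<rho>"
    by (rule finite_measure_pair_measure) unfold_locales
  have space_\<mu>: "space \<mu> = {0..T}" by (simp add: \<mu>_def space_restrict_space)
  have [measurable]: "(\<lambda>t. t) \<in> borel_measurable \<mu>" "(\<lambda>t. t) \<in> borel_measurable (discounted_time T \<rho>)"
    unfolding \<mu>_def
    by (auto intro!: measurable_restrict_space1 simp: measurable_cong_sets[OF sets_discounted_time refl])
  have "integrable (\<mu> \<Otimes>\<^sub>M discounted_time T \<rho>) (\<lambda>(t, s). indicator {t..} s :: real)"
  proof (rule P'.integrable_const_bound[where B=1])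
    \<comment> \<open>The indicator of a moving set becomes a comparison of the two coordinates,
      whose measurability is automatic.\<close>
    have eq: "(\<lambda>(t::real, s). indicator {t..} s :: real)
        = (\<lambda>p. if (fst p) \<le> (snd p) then 1 else 0)" by (auto simp: indicator_def)
    show "(\<lambda>(t, s). indicator {t..} s :: real) \<in> borel_measurable (\<mu> \<Otimes>\<^sub>M discounted_time T \<rho>)"
      unfolding eq by measurable
  qed (auto simp: indicator_def)
  from P.Fubini_integral[OF this]
  have swap: "(\<integral>s. \<integral>t. indicator {t..} s \<partial>\<mu> \<partial>discounted_time T \<rho>)
      = (\<integral>t. \<integral>s. indicator {t..} s \<partial>discounted_time T \<rho> \<partial>\<mu> :: real)" .
  have inner: "(\<integral>t. indicator {t..} s \<partial>\<mu> :: real) = f s" if "s \<in> {0..T}" for s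
  proof -
    have "(\<integral>t. indicator {t..} s \<partial>\<mu> :: real)
        = (\<integral>t. indicator {0..T} t *\<^sub>R indicator {t..} s \<partial>interval_measure G)"
      unfolding \<mu>_def by (rule integral_restrict_space) simp
    also have "\<dots> = (\<integral>t. indicator {0..s} t \<partial>interval_measure G)"
    proof (intro Bochner_Integration.integral_cong refl)
      show "indicator {0..T} t *\<^sub>R indicator {t..} s = (indicator {0..s} t :: real)" for t
        using that by (cases "t \<in> {0..s}") auto
    qed
    also have "\<dots> = f s" using Icc[OF that] f_nonneg[OF that] by (simp add: measure_def)
    finally show ?thesis .
  qed
  have "stieltjes_integral T (\<lambda>t. exp (- \<rho> * t)) f = (\<integral>t. exp (- \<rho> * t) \<partial>\<mu>)"
    unfolding stieltjes_integral_def \<mu>_def set_lebesgue_integral_def G_def[symmetric]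
    by (subst integral_restrict_space) auto
  also have "\<dots> = (\<integral>t. exp (- \<rho> * T) + \<rho> * (\<integral>s. indicator {t..} s \<partial>discounted_time T \<rho>) \<partial>\<mu>)"
  proof (intro Bochner_Integration.integral_cong refl)
    fix t assume "t \<in> space \<mu>"
    then have t: "0 \<le> t" "t \<le> T" by (auto simp: space_\<mu>)
    have "(\<integral>s. indicator {t..} s \<partial>discounted_time T \<rho>)
        = (\<integral>s. indicator {t..T} s \<partial>discounted_time T \<rho> :: real)"
      by (intro Bochner_Integration.integral_cong) (auto simp: indicator_def)
    then show "exp (- \<rho> * t) = exp (- \<rho> * T) + \<rho> * (\<integral>s. indicator {t..} s \<partial>discounted_time T \<rho>)"
      using integral_discounted_tail[OF assms(2) t] by simp
  qed
  also have "\<dots> = exp (- \<rho> * T) * measure \<mu> (space \<mu>)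
      + \<rho> * (\<integral>t. \<integral>s. indicator {t..} s \<partial>discounted_time T \<rho> \<partial>\<mu>)"
    using P.integrable_fst'[OF \<open>integrable (\<mu> \<Otimes>\<^sub>M discounted_time T \<rho>) _\<close>]
    by (subst Bochner_Integration.integral_add) auto
  also have "measure \<mu> (space \<mu>) = f T"
    using Icc[of T] f_nonneg[of T] assms
    unfolding \<mu>_def by (simp add: emeasure_restrict_space space_restrict_space measure_def)
  also have "(\<integral>t. \<integral>s. indicator {t..} s \<partial>discounted_time T \<rho> \<partial>\<mu>) = (\<integral>s. f s \<partial>discounted_time T \<rho>)"
    unfolding swap[symmetric] by (intro Bochner_Integration.integral_cong inner) auto
  finally show ?thesis .
qed

section \<open>Measurability, right-continuous paths and elementary inequalities\<close>

text \<open>Completeness is what gives meaning to pathwise expressions such as the integrand of the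
  cost: they are only known to agree almost surely with something measurable.\<close>

lemma (in complete_measure) borel_measurable_AE_eq:
  fixes f g :: "'a \<Rightarrow> 'b::topological_space"
  assumes g: "g \<in> borel_measurable M" and eq: "AE x in M. f x = g x"
  shows "f \<in> borel_measurable M"
proof (rule measurableI)
  fix A :: "'b set" assume A: "A \<in> sets borel"
  show "f -` A \<inter> space M \<in> sets M"
  proof (rule in_sets_AE)
    show "AE x in M. x \<in> g -` A \<inter> space M \<longleftrightarrow> x \<in> f -` A \<inter> space M"
      using eq by eventually_elim auto
    show "g -` A \<inter> space M \<in> sets M" using g A by (rule measurable_sets)
  qed auto
qed auto

lemma (in complete_measure) integral_cong_AE_complete:
  fixes f g :: "'a \<Rightarrow> real"
  assumes "g \<in> borel_measurable M" "AE x in M. f x = g x"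
  shows "integral\<^sup>L M f = integral\<^sup>L M g"
  using borel_measurable_AE_eq[OF assms] assms by (intro integral_cong_AE) auto

lemma integrable_mult_square:
  fixes f g :: "'a \<Rightarrow> real"
  assumes [measurable]: "f \<in> borel_measurable M" "g \<in> borel_measurable M"
    and "integrable M (\<lambda>x. (f x)\<^sup>2)" "integrable M (\<lambda>x. (g x)\<^sup>2)"
  shows "integrable M (\<lambda>x. f x * g x)"
proof (rule Bochner_Integration.integrable_bound)
  show "integrable M (\<lambda>x. (f x)\<^sup>2 + (g x)\<^sup>2)" using assms by simp
  have "\<bar>a * b\<bar> \<le> \<bar>a\<^sup>2 + b\<^sup>2\<bar>" for a b :: real
  proof -
    have "0 \<le> (\<bar>a\<bar> - \<bar>b\<bar>)\<^sup>2" by simp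
    then have "2 * (\<bar>a\<bar> * \<bar>b\<bar>) \<le> a\<^sup>2 + b\<^sup>2" by (simp add: power2_diff)
    moreover have "0 \<le> \<bar>a\<bar> * \<bar>b\<bar>" by simp
    ultimately show ?thesis unfolding abs_mult by linarith
  qed
  then show "AE x in M. norm (f x * g x) \<le> norm ((f x)\<^sup>2 + (g x)\<^sup>2)" by simp
qed simp

lemma integrable_square_add:
  fixes f g :: "'a \<Rightarrow> real"
  assumes [measurable]: "f \<in> borel_measurable M" "g \<in> borel_measurable M"
    and "integrable M (\<lambda>x. (f x)\<^sup>2)" "integrable M (\<lambda>x. (g x)\<^sup>2)"
  shows "integrable M (\<lambda>x. (a * f x + b * g x)\<^sup>2)"
proof -
  have "(\<lambda>x. (a * f x + b * g x)\<^sup>2) = (\<lambda>x. a\<^sup>2 * (f x)\<^sup>2 + 2 * a * b * (f x * g x) + b\<^sup>2 * (g x)\<^sup>2)"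
    by (auto simp: power2_eq_square algebra_simps)
  with integrable_mult_square[OF assms] assms show ?thesis by simp
qed

lemma (in prob_space) square_expectation_le:
  fixes X :: "'a \<Rightarrow> real"
  assumes "X \<in> borel_measurable M" "integrable M (\<lambda>\<omega>. (X \<omega>)\<^sup>2)"
  shows "(expectation X)\<^sup>2 \<le> expectation (\<lambda>\<omega>. (X \<omega>)\<^sup>2)"
proof -
  have "integrable M X" using assms by (rule square_integrable_imp_integrable)
  from variance_eq[OF this assms(2)] variance_positive[of X] show ?thesis by linarith
qed

text \<open>The grid points lie to the right of \<open>t\<close>, so right-continuous paths are recovered in the limit.\<close>

definition grid :: "real \<Rightarrow> nat \<Rightarrow> real \<Rightarrow> real" where
  "grid T n t = min T (max 0 (of_int \<lceil>t * (real n + 1)\<rceil> / (real n + 1)))"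

lemma grid_bounds:
  assumes "t \<in> {0..T}"
  shows "t \<le> grid T n t" "grid T n t \<in> {0..T}" "grid T n t \<le> t + 1 / (real n + 1)"
proof -
  have "t * (real n + 1) \<le> of_int \<lceil>t * (real n + 1)\<rceil>" by simp
  then have "t \<le> of_int \<lceil>t * (real n + 1)\<rceil> / (real n + 1)" by (simp add: field_simps)
  then show "t \<le> grid T n t" "grid T n t \<in> {0..T}" using assms by (auto simp: grid_def)
  have "of_int \<lceil>t * (real n + 1)\<rceil> \<le> t * (real n + 1) + 1" by linarith
  then have "of_int \<lceil>t * (real n + 1)\<rceil> / (real n + 1) \<le> (t * (real n + 1) + 1) / (real n + 1)"
    by (intro divide_right_mono) auto
  also have "\<dots> = t + 1 / (real n + 1)" by (simp add: field_simps)
  finally show "grid T n t \<le> t + 1 / (real n + 1)"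
    using assms by (auto simp: grid_def min_le_iff_disj)
qed

lemma grid_tendsto:
  assumes "t \<in> {0..T}" shows "(\<lambda>n. grid T n t) \<longlonglongrightarrow> t"
proof (rule tendsto_sandwich[OF _ _ tendsto_const])
  show "\<forall>\<^sub>F n in sequentially. t \<le> grid T n t"
    "\<forall>\<^sub>F n in sequentially. grid T n t \<le> t + 1 / (real n + 1)"
    using grid_bounds[OF assms] by auto
  have "(\<lambda>n. t + 1 / (real (Suc n))) \<longlonglongrightarrow> t + 0"
    by (intro tendsto_intros LIMSEQ_Suc[OF lim_1_over_n])
  then show "(\<lambda>n. t + 1 / (real n + 1)) \<longlonglongrightarrow> t" by (simp add: add.commute)
qed

text \<open>A right-continuous process is the limit of its values at grid points to the right. Each
  approximation takes countably many time values, hence is jointly measurable. Setting the paths in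
  the exceptional null set \<open>N\<close> to 0 makes the convergence hold at every point of the
  product.\<close>

lemma ex_jointly_measurable_version:
  fixes Z :: "real \<Rightarrow> 'a \<Rightarrow> real"
  assumes meas: "\<And>t. t \<in> {0..T} \<Longrightarrow> Z t \<in> borel_measurable M"
    and rc: "AE \<omega> in M. \<forall>t\<in>{0..<T}. ((\<lambda>s. Z s \<omega>) \<longlongrightarrow> Z t \<omega>) (at_right t)"
  shows "\<exists>g\<in>borel_measurable (restrict_space borel {0..T} \<Otimes>\<^sub>M M).
    AE \<omega> in M. \<forall>t\<in>{0..T}. g (t, \<omega>) = Z t \<omega>"
proof (cases "0 \<le> T")
  case True
  let ?P = "restrict_space borel {0..T} \<Otimes>\<^sub>M M"
  obtain N where N: "N \<in> null_sets M"
    and good: "\<And>\<omega>. \<omega> \<in> space M \<Longrightarrow> \<omega> \<notin> N \<Longrightarrow>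
      \<forall>t\<in>{0..<T}. ((\<lambda>s. Z s \<omega>) \<longlongrightarrow> Z t \<omega>) (at_right t)"
    using rc by (auto elim!: AE_E3)
  have [measurable]: "N \<in> sets M" using N by auto
  have fst_meas: "fst \<in> borel_measurable ?P"
    by (rule measurable_compose[OF measurable_fst]) (intro measurable_restrict_space1 measurable_ident_sets refl)
  define u where "u n p = (if snd p \<in> N then 0 else Z (grid T n (fst p)) (snd p))" for n p
  have u_meas: "u n \<in> borel_measurable ?P" for n
  proof -
    have "(\<lambda>p. Z (grid T n (fst p)) (snd p)) \<in> borel_measurable ?P"
    proof -
      \<comment> \<open>For a fixed value k of the ceiling the time is frozen and only a random
        variable remains; countably many k are then glued together.\<close>
      have "(\<lambda>p. (\<lambda>k p. Z (min T (max 0 (of_int k / (real n + 1)))) (snd p))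
          \<lceil>fst p * (real n + 1)\<rceil> p) \<in> borel_measurable ?P"
      proof (rule measurable_compose_countable[where
            f = "\<lambda>k p. Z (min T (max 0 (of_int k / (real n + 1)))) (snd p)"])
        show "(\<lambda>p. Z (min T (max 0 (of_int k / (real n + 1)))) (snd p)) \<in> borel_measurable ?P" for k :: int
          by (rule measurable_compose[OF measurable_snd meas]) (use True in auto)
        show "(\<lambda>p. \<lceil>fst p * (real n + 1)\<rceil>) \<in> ?P \<rightarrow>\<^sub>M count_space UNIV"
          by (rule measurable_compose[OF borel_measurable_times[OF fst_meas measurable_const]]) simp_all
      qed
      then show ?thesis unfolding grid_def .
    qed
    then show ?thesis unfolding u_def by measurable
  qed
  define g where "g p = (if snd p \<in> N then 0 else Z (fst p) (snd p))" for p
  have "g \<in> borel_measurable ?P"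
  proof (rule borel_measurable_LIMSEQ_real)
    fix p assume "p \<in> space ?P"
    then obtain t \<omega> where p: "p = (t, \<omega>)" "t \<in> {0..T}" "\<omega> \<in> space M"
      by (auto simp: space_pair_measure space_restrict_space)
    show "(\<lambda>n. u n p) \<longlonglongrightarrow> g p"
    proof (cases "\<omega> \<in> N \<or> t = T")
      case True
      then show ?thesis
      proof
        assume "t = T"
        \<comment> \<open>At T there is no right limit to use, but the clamped grid hits T
          exactly.\<close>
        then have "grid T n t = t" for n using grid_bounds[OF p(2), of n] by auto
        then show ?thesis by (simp add: u_def g_def p)
      qed (simp add: u_def g_def p)
    next
      case False
      then have "((\<lambda>s. Z s \<omega>) \<longlongrightarrow> Z t \<omega>) (at t within {t..})"
        using good[OF p(3)] p(2) by (auto simp: at_within_Ici_at_right)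
      then have "(\<lambda>n. Z (grid T n t) \<omega>) \<longlonglongrightarrow> Z t \<omega>"
        using continuous_within_tendsto_compose'[of t "{t..}" "\<lambda>s. Z s \<omega>", OF _ _ grid_tendsto[OF p(2)]]
          grid_bounds(1)[OF p(2)] by (auto simp: continuous_within)
      then show ?thesis using False by (simp add: u_def g_def p)
    qed
  qed (rule u_meas)
  moreover have "AE \<omega> in M. \<forall>t\<in>{0..T}. g (t, \<omega>) = Z t \<omega>"
    using AE_not_in[OF N] by eventually_elim (auto simp: g_def)
  ultimately show ?thesis by blast
qed (rule bexI[of _ "\<lambda>_. 0"], simp_all)

text \<open>A nonzero right limit would make \<open>f\<close> nonzero on a whole interval to the
  right of \<open>t\<close>, cut off at T, and this interval has positive length.\<close>

lemma right_continuous_AE_zero: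
  fixes f :: "real \<Rightarrow> real"
  assumes ae: "AE t in lborel. t \<in> {0..T} \<longrightarrow> f t = 0" and lim: "(f \<longlongrightarrow> l) (at_right t)"
    and t: "0 \<le> t" "t < T"
  shows "l = 0"
proof (rule ccontr)
  assume "l \<noteq> 0"
  with lim have "\<forall>\<^sub>F s in at_right t. f s \<noteq> 0"
    by (rule tendsto_imp_eventually_ne)
  then obtain b where b: "b > t" "\<And>s. t < s \<Longrightarrow> s < b \<Longrightarrow> f s \<noteq> 0"
    unfolding eventually_at_right_field by auto
  have "AE s in lborel. s \<notin> {t<..<min b T}"
    using ae by eventually_elim (use b t in auto)
  then have "emeasure lborel {t<..<min b T} = 0"
    by (subst (asm) AE_iff_null_sets[symmetric]) auto
  then show False using b t by simp
qed

text \<open>The equation improves its own regularity: an integrable \<open>u\<close> has a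
  continuous indefinite integral, so \<open>u\<close> is continuous and \<open>G\<close> is
  differentiable with G' = -\<rho> G. The integrating factor exp (\<rho> t) makes the product
  constant, and G vanishes at 0.\<close>

lemma linear_integral_equation_zero:
  fixes u :: "real \<Rightarrow> real"
  assumes "set_integrable lborel {0..T} u"
    and eq: "\<And>b. b \<in> {0..T} \<Longrightarrow> u b = - \<rho> * (LINT t:{0..b}|lborel. u t)"
    and "b \<in> {0..T}"
  shows "u b = 0"
proof -
  define G where "G b = integral {0..b} u" for b
  have int: "u integrable_on {0..T}"
    using assms(1) by (simp add: set_borel_integral_eq_integral)
  have u: "u b = - \<rho> * G b" if "b \<in> {0..T}" for b
  proof -
    have "set_integrable lborel {0..b} u"
      by (rule set_integrable_subset[OF assms(1)]) (use that in auto)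
    then show ?thesis using eq[OF that] by (simp add: G_def set_borel_integral_eq_integral)
  qed
  have contG: "continuous_on {0..T} G"
    unfolding G_def by (rule indefinite_integral_continuous_1[OF int])
  then have "continuous_on {0..T} (\<lambda>b. - \<rho> * G b)" by (intro continuous_intros)
  then have cont: "continuous_on {0..T} u" by (rule continuous_on_eq) (simp add: u)
  have "((\<lambda>t. exp (\<rho> * t) * G t) has_real_derivative 0) (at t within {0..T})" if "t \<in> {0..T}" for t
  proof -
    have "(G has_real_derivative u t) (at t within {0..T})"
      unfolding G_def has_real_derivative_iff_has_vector_derivative
      by (rule integral_has_vector_derivative[OF cont that])
    then have "((\<lambda>t. exp (\<rho> * t) * G t) has_real_derivative
        exp (\<rho> * t) * (\<rho> * 1) * G t + u t * exp (\<rho> * t)) (at t within {0..T})"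
      by (intro DERIV_mult) (auto intro!: derivative_eq_intros)
    then show ?thesis by (simp add: u[OF that] mult_ac)
  qed
  then obtain c where c: "\<And>t. t \<in> {0..T} \<Longrightarrow> exp (\<rho> * t) * G t = c"
    using has_field_derivative_zero_constant[of "{0..T}" "\<lambda>t. exp (\<rho> * t) * G t"] by auto
  have "G 0 = 0" by (simp add: G_def)
  then have "c = 0" using c[of 0] assms(3) by simp
  then show ?thesis using u[OF assms(3)] c[OF assms(3)] by simp
qed

section \<open>Operations on cadlag paths and the first-order condition\<close>

lemma cadlag_on_stopped:
  assumes f: "cadlag_on T f" and b: "b \<in> {0..T}"
  shows "cadlag_on T (\<lambda>t. f (min t b))"
  unfolding cadlag_on_def
proof (intro conjI ballI)
  fix t assume t: "t \<in> {0..<T}"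
  show "((\<lambda>s. f (min s b)) \<longlongrightarrow> f (min t b)) (at_right t)"
  proof (cases "t < b")
    case True
    then have "\<forall>\<^sub>F s in at_right t. f s = f (min s b)"
      by (intro eventually_at_rightI[of t b]) auto
    from Lim_transform_eventually[OF _ this, of "f t"] show ?thesis
      using f t True by (auto simp: cadlag_on_def)
  next
    case False
    then have "\<forall>\<^sub>F s in at_right t. f (min s b) = f b"
      by (intro eventually_at_rightI[of t "t + 1"]) auto
    from tendsto_eventually[OF this] show ?thesis using False by (simp add: min_absorb2)
  qed
next
  fix t assume t: "t \<in> {0<..T}"
  show "\<exists>l. ((\<lambda>s. f (min s b)) \<longlongrightarrow> l) (at_left t)"
  proof (cases "t \<le> b")
    case True
    then have "\<forall>\<^sub>F s in at_left t. f s = f (min s b)"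
      by (intro eventually_at_leftI[of "t - 1" t]) auto
    moreover obtain l where "(f \<longlongrightarrow> l) (at_left t)" using f t unfolding cadlag_on_def by blast
    ultimately show ?thesis by (blast intro: Lim_transform_eventually)
  next
    case False
    then have "\<forall>\<^sub>F s in at_left t. f (min s b) = f b"
      by (intro eventually_at_leftI[of b t]) auto
    then show ?thesis by (blast intro: tendsto_eventually)
  qed
qed

lemma cadlag_on_combination:
  assumes "cadlag_on T f" "cadlag_on T g"
  shows "cadlag_on T (\<lambda>t. a * f t + b * g t)"
  unfolding cadlag_on_def
proof (intro conjI ballI)
  fix t assume "t \<in> {0..<T}"
  then show "((\<lambda>t. a * f t + b * g t) \<longlongrightarrow> a * f t + b * g t) (at_right t)"
    using assms by (intro tendsto_intros) (auto simp: cadlag_on_def)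
next
  fix t assume "t \<in> {0<..T}"
  then obtain l m where "(f \<longlongrightarrow> l) (at_left t)" "(g \<longlongrightarrow> m) (at_left t)"
    using assms unfolding cadlag_on_def by blast
  then have "((\<lambda>t. a * f t + b * g t) \<longlongrightarrow> a * l + b * m) (at_left t)"
    by (intro tendsto_intros)
  then show "\<exists>l. ((\<lambda>t. a * f t + b * g t) \<longlongrightarrow> l) (at_left t)" by blast
qed

text \<open>Dividing by \<open>e\<close> and letting it decrease to 0 isolates the first-order term.
  The range stops at 1 because \<open>e\<close> will be the weight of a convex combination.\<close>

lemma nonneg_of_quadratic_perturbation:
  fixes A B :: real
  assumes "\<And>e. 0 < e \<Longrightarrow> e \<le> 1 \<Longrightarrow> 0 \<le> e * A + e\<^sup>2 * B"
  shows "0 \<le> A"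
proof (rule tendsto_lowerbound)
  show "((\<lambda>e. A + e * B) \<longlongrightarrow> A) (at_right 0)"
    by (auto intro!: tendsto_eq_intros)
  show "\<forall>\<^sub>F e in at_right (0::real). 0 \<le> A + e * B"
  proof (rule eventually_at_rightI[of 0 1])
    fix e :: real assume e: "e \<in> {0<..<1}"
    then have "0 \<le> e * (A + e * B)"
      using assms[of e] by (simp add: power2_eq_square algebra_simps)
    with e show "0 \<le> A + e * B" by (simp add: zero_le_mult_iff)
  qed simp
qed simp

section \<open>The variational inequality for a solution\<close>

locale mean_field_follower = brownian_filtered_space M F T W
  for M :: "'a measure" and F :: "real \<Rightarrow> 'a measure" and T :: real and W :: "real \<Rightarrow> 'a \<Rightarrow> real" +
  fixes \<sigma> \<rho> K \<alpha> x :: real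
  assumes T_pos: "T > 0" and \<rho>_pos: "\<rho> > 0" and K_pos: "K > 0"
begin

abbreviation D :: "real measure" where "D \<equiv> discounted_time T \<rho>"
abbreviation P :: "(real \<times> 'a) measure" where "P \<equiv> D \<Otimes>\<^sub>M M"
abbreviation controls :: "(real \<Rightarrow> 'a \<Rightarrow> real) set" where "controls \<equiv> monotone_controls M F T"
abbreviation state :: "(real \<Rightarrow> 'a \<Rightarrow> real) \<Rightarrow> real \<Rightarrow> 'a \<Rightarrow> real" where
  "state \<equiv> controlled_state x \<sigma> W"

section \<open>The product of discounted time and scenarios\<close>

sublocale D: finite_measure D
  by (rule finite_measure_discounted_time[OF \<rho>_pos])

sublocale P: pair_sigma_finite D M ..

sublocale P': finite_measure P
  by (rule finite_measure_pair_measure) unfold_locales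

lemma integral_lift_time:
  fixes f :: "real \<Rightarrow> real"
  assumes [measurable]: "f \<in> borel_measurable D"
  shows "integrable P (\<lambda>p. f (fst p)) \<longleftrightarrow> integrable D f"
    and "(\<integral>p. f (fst p) \<partial>P) = integral\<^sup>L D f"
  using integrable_distr_eq[of fst P D f] integral_distr[of fst P D f]
  by (simp_all add: distr_pair_fst)

text \<open>Paths are jointly measurable only after modification on a null set of scenarios.\<close>

definition version :: "(real \<Rightarrow> 'a \<Rightarrow> real) \<Rightarrow> (real \<times> 'a \<Rightarrow> real) \<Rightarrow> bool" where
  "version Z g \<longleftrightarrow> g \<in> borel_measurable P \<and> integrable P (\<lambda>p. (g p)\<^sup>2) \<and>
     (AE \<omega> in M. \<forall>t\<in>{0..T}. g (t, \<omega>) = Z t \<omega>)"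

lemma
  assumes "version Z g"
  shows version_measurable: "g \<in> borel_measurable P"
    and version_square_integrable: "integrable P (\<lambda>p. (g p)\<^sup>2)"
    and version_AE: "AE \<omega> in M. \<forall>t\<in>{0..T}. g (t, \<omega>) = Z t \<omega>"
  using assms unfolding version_def by auto

lemma version_integrable:
  assumes "version Z g" shows "integrable P g"
  using P'.square_integrable_imp_integrable[OF version_measurable[OF assms] version_square_integrable[OF assms]] .

text \<open>Second moments bounded uniformly in time are integrable over time because discounted
  time has finite mass; Tonelli then gives square-integrability on the product.\<close>

lemma ex_version:
  assumes meas: "\<And>t. t \<in> {0..T} \<Longrightarrow> Z t \<in> borel_measurable M"
    and rc: "AE \<omega> in M. \<forall>t\<in>{0..<T}. ((\<lambda>s. Z s \<omega>) \<longlongrightarrow> Z t \<omega>) (at_right t)"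
    and bound: "\<And>t. t \<in> {0..T} \<Longrightarrow> integrable M (\<lambda>\<omega>. (Z t \<omega>)\<^sup>2)"
      "\<And>t. t \<in> {0..T} \<Longrightarrow> (\<integral>\<omega>. (Z t \<omega>)\<^sup>2 \<partial>M) \<le> C"
  shows "\<exists>g. version Z g"
proof -
  obtain g where g: "g \<in> borel_measurable (restrict_space borel {0..T} \<Otimes>\<^sub>M M)"
    and ae: "AE \<omega> in M. \<forall>t\<in>{0..T}. g (t, \<omega>) = Z t \<omega>"
    using ex_jointly_measurable_version[OF meas rc] by blast
  have "sets (restrict_space borel {0..T} \<Otimes>\<^sub>M M) = sets P"
    by (intro sets_pair_measure_cong sets_discounted_time[symmetric] refl)
  with g have [measurable]: "g \<in> borel_measurable P"
    using measurable_cong_sets by blast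
  have sec: "integrable M (\<lambda>\<omega>. (g (t, \<omega>))\<^sup>2)" "(\<integral>\<omega>. (g (t, \<omega>))\<^sup>2 \<partial>M) \<le> C"
    if t: "t \<in> {0..T}" for t
  proof -
    have [measurable]: "(\<lambda>\<omega>. g (t, \<omega>)) \<in> borel_measurable M" "Z t \<in> borel_measurable M"
      using t meas[OF t] by (auto intro!: measurable_compose[OF measurable_Pair1'])
    have eq: "AE \<omega> in M. (g (t, \<omega>))\<^sup>2 = (Z t \<omega>)\<^sup>2"
      using ae by eventually_elim (use t in auto)
    show "integrable M (\<lambda>\<omega>. (g (t, \<omega>))\<^sup>2)"
      using bound(1)[OF t] by (subst integrable_cong_AE[OF _ _ eq]) auto
    show "(\<integral>\<omega>. (g (t, \<omega>))\<^sup>2 \<partial>M) \<le> C"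
      using bound(2)[OF t] by (subst integral_cong_AE[OF _ _ eq]) auto
  qed
  have "integrable P (\<lambda>p. (g p)\<^sup>2)"
  proof (rule P.Fubini_integrable)
    show "integrable D (\<lambda>t. \<integral>\<omega>. norm ((g (t, \<omega>))\<^sup>2) \<partial>M)"
    proof (rule D.integrable_const_bound[where B=C])
      show "AE t in D. norm (\<integral>\<omega>. norm ((g (t, \<omega>))\<^sup>2) \<partial>M) \<le> C"
        using sec by (intro AE_I2) simp
    qed simp
    show "AE t in D. integrable M (\<lambda>\<omega>. (g (t, \<omega>))\<^sup>2)"
      using sec by (intro AE_I2) simp
  qed simp
  with ae \<open>g \<in> borel_measurable P\<close> show ?thesis unfolding version_def by blast
qed

lemma version_add:
  assumes "version Z g" "version Z' g'"
  shows "version (\<lambda>t \<omega>. a * Z t \<omega> + b * Z' t \<omega>) (\<lambda>p. a * g p + b * g' p)"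
proof -
  have "AE \<omega> in M. \<forall>t\<in>{0..T}. a * g (t, \<omega>) + b * g' (t, \<omega>) = a * Z t \<omega> + b * Z' t \<omega>"
    using version_AE[OF assms(1)] version_AE[OF assms(2)] by eventually_elim auto
  then show ?thesis
    using integrable_square_add[of g P g'] assms unfolding version_def by auto
qed

lemma version_const: "version (\<lambda>t \<omega>. c) (\<lambda>p. c)"
  unfolding version_def by auto

lemma version_section:
  assumes "version Z g" "t \<in> {0..T}"
  shows "(\<lambda>\<omega>. g (t, \<omega>)) \<in> borel_measurable M" "AE \<omega> in M. g (t, \<omega>) = Z t \<omega>"
    "Z t \<in> borel_measurable M"
    "(\<integral>\<omega>. g (t, \<omega>) \<partial>M) = (\<integral>\<omega>. Z t \<omega> \<partial>M)"
proof -
  show 1: "(\<lambda>\<omega>. g (t, \<omega>)) \<in> borel_measurable M"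
    using assms version_measurable[OF assms(1)] by (auto intro!: measurable_compose[OF measurable_Pair1'])
  show 2: "AE \<omega> in M. g (t, \<omega>) = Z t \<omega>"
    using version_AE[OF assms(1)] by eventually_elim (use assms in auto)
  then have 3: "AE \<omega> in M. Z t \<omega> = g (t, \<omega>)" by eventually_elim simp
  show "Z t \<in> borel_measurable M" by (rule borel_measurable_AE_eq[OF 1 3])
  show "(\<integral>\<omega>. g (t, \<omega>) \<partial>M) = (\<integral>\<omega>. Z t \<omega> \<partial>M)"
    using integral_cong_AE_complete[OF 1 3] by simp
qed

text \<open>Measurability in time comes from Fubini for the version, and the squared mean is at most
  the second moment. Through the consistency condition this makes the mean-field function of a
  solution square-integrable, although a solution is only asked to have a measurable one.\<close>

lemma version_mean:
  assumes Z: "version Z g" and m: "\<And>t. t \<in> {0..T} \<Longrightarrow> m t = (\<integral>\<omega>. Z t \<omega> \<partial>M)"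
  shows "m \<in> borel_measurable D" "integrable D (\<lambda>t. (m t)\<^sup>2)"
proof -
  note [measurable] = version_measurable[OF Z]
  have eq: "m t = (\<integral>\<omega>. g (t, \<omega>) \<partial>M)" if "t \<in> {0..T}" for t
    using version_section(4)[OF Z that] m[OF that] by simp
  have "(\<lambda>t. \<integral>\<omega>. g (t, \<omega>) \<partial>M) \<in> borel_measurable D" by measurable
  then show [measurable]: "m \<in> borel_measurable D"
    by (rule measurable_cong[THEN iffD1, rotated]) (simp add: eq)
  show "integrable D (\<lambda>t. (m t)\<^sup>2)"
  proof (rule Bochner_Integration.integrable_bound)
    show "integrable D (\<lambda>t. \<integral>\<omega>. (g (t, \<omega>))\<^sup>2 \<partial>M)"
      using P.integrable_fst'[OF version_square_integrable[OF Z]] .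
    have "AE t in D. t \<in> {0..T}" by (intro AE_I2) simp
    with P.AE_integrable_fst'[OF version_square_integrable[OF Z]]
    show "AE t in D. norm ((m t)\<^sup>2) \<le> norm (\<integral>\<omega>. (g (t, \<omega>))\<^sup>2 \<partial>M)"
    proof eventually_elim
      case (elim t)
      then show ?case
        using square_expectation_le[OF version_section(1)[OF Z] elim(1)] eq[of t]
        by (simp add: Bochner_Integration.integral_nonneg)
    qed
  qed simp
qed

text \<open>Fubini with the factor \<open>f\<close> constant in the scenario. It serves twice: for
  the cross term of the mean gap with the gap, and to show that a centred state is orthogonal to
  every square-integrable function of time.\<close>

lemma integral_mean_mult:
  assumes Z: "version Z g" and m: "\<And>t. t \<in> {0..T} \<Longrightarrow> m t = (\<integral>\<omega>. Z t \<omega> \<partial>M)"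
    and f: "f \<in> borel_measurable D" "integrable D (\<lambda>t. (f t)\<^sup>2)"
  shows "integrable P (\<lambda>p. f (fst p) * g p)"
    "(\<integral>p. f (fst p) * g p \<partial>P) = (\<integral>t. f t * m t \<partial>D)"
proof -
  note [measurable] = version_measurable[OF Z] f(1)
  have "integrable P (\<lambda>p. (f (fst p))\<^sup>2)"
    using integral_lift_time(1)[of "\<lambda>t. (f t)\<^sup>2"] f by simp
  then show int: "integrable P (\<lambda>p. f (fst p) * g p)"
    by (intro integrable_mult_square version_square_integrable[OF Z]) auto
  have "(\<integral>p. f (fst p) * g p \<partial>P) = (\<integral>t. \<integral>\<omega>. f t * g (t, \<omega>) \<partial>M \<partial>D)"
    using P.integral_fst'[OF int] by simp
  also have "\<dots> = (\<integral>t. f t * m t \<partial>D)"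
    using version_section(4)[OF Z] m by (intro Bochner_Integration.integral_cong) auto
  finally show "(\<integral>p. f (fst p) * g p \<partial>P) = (\<integral>t. f t * m t \<partial>D)" .
qed

text \<open>The law is given only for increments over intervals of positive length and the start at
  0 holds only almost surely. Hence time 0 is treated apart, and elsewhere \<open>W t\<close> is
  exchanged for its increment from time 0.\<close>

lemma brownian_moments:
  assumes t: "t \<in> {0..T}"
  shows "W t \<in> borel_measurable M" "integrable M (\<lambda>\<omega>. (W t \<omega>)\<^sup>2)"
    "(\<integral>\<omega>. (W t \<omega>)\<^sup>2 \<partial>M) = t"
proof -
  have meas [measurable]: "W s \<in> borel_measurable M" if "s \<in> {0..T}" for s
    using measurable_from_subalg[OF subalgebra_F[OF that] W_adapted[OF that]] .
  show "W t \<in> borel_measurable M" by (rule meas[OF t])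
  have *: "integrable M (\<lambda>\<omega>. (W t \<omega>)\<^sup>2) \<and> (\<integral>\<omega>. (W t \<omega>)\<^sup>2 \<partial>M) = t"
  proof (cases "t = 0")
    case True
    have eq: "AE \<omega> in M. (W t \<omega>)\<^sup>2 = 0" using W_0 by eventually_elim (simp add: True)
    show ?thesis using meas[OF t]
      by (subst integrable_cong_AE[OF _ _ eq], simp_all, subst integral_cong_AE[OF _ _ eq])
         (simp_all add: True)
  next
    case False
    with t have "0 < t" "0 < sqrt t" by auto
    have dist: "distributed M lborel (\<lambda>\<omega>. W t \<omega> - W 0 \<omega>) (normal_density 0 (sqrt t))"
      using W_normal[of 0 t] \<open>0 < t\<close> t by simp
    have i: "integrable M (\<lambda>\<omega>. (W t \<omega> - W 0 \<omega>)\<^sup>2)"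
      using distributed_integrable[OF dist, of "\<lambda>y. y\<^sup>2"] integrable_normal_moment[OF \<open>0 < sqrt t\<close>, of 0 2]
      by simp
    have e: "(\<integral>\<omega>. (W t \<omega> - W 0 \<omega>)\<^sup>2 \<partial>M) = t"
      using normal_distributed_variance[OF \<open>0 < sqrt t\<close> dist]
        normal_distributed_expectation[OF \<open>0 < sqrt t\<close> dist] \<open>0 < t\<close> by simp
    have eq: "AE \<omega> in M. (W t \<omega>)\<^sup>2 = (W t \<omega> - W 0 \<omega>)\<^sup>2"
      using W_0 by eventually_elim simp
    show ?thesis using meas[OF t] meas[of 0] i e T_pos
      by (simp add: integrable_cong_AE[OF _ _ eq] integral_cong_AE[OF _ _ eq])
  qed
  then show "integrable M (\<lambda>\<omega>. (W t \<omega>)\<^sup>2)" "(\<integral>\<omega>. (W t \<omega>)\<^sup>2 \<partial>M) = t" by auto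
qed

lemma ex_version_brownian: "\<exists>w. version W w"
proof (rule ex_version[where C=T])
  show "AE \<omega> in M. \<forall>t\<in>{0..<T}. ((\<lambda>s. W s \<omega>) \<longlongrightarrow> W t \<omega>) (at_right t)"
    using W_cont
  proof eventually_elim
    case (elim \<omega>)
    show ?case
    proof
      fix t assume t: "t \<in> {0..<T}"
      have "((\<lambda>s. W s \<omega>) \<longlongrightarrow> W t \<omega>) (at t within {t..T})"
        using continuous_on_subset[OF elim, of "{t..T}"] t by (auto simp: continuous_on_def)
      then show "((\<lambda>s. W s \<omega>) \<longlongrightarrow> W t \<omega>) (at_right t)"
        using t by (simp add: at_within_Icc_at_right)
    qed
  qed
qed (auto simp: brownian_moments)

lemma
  assumes "\<xi> \<in> controls"
  shows controls_adapted: "\<And>t. t \<in> {0..T} \<Longrightarrow> \<xi> t \<in> borel_measurable (F t)"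
    and controls_measurable: "\<And>t. t \<in> {0..T} \<Longrightarrow> \<xi> t \<in> borel_measurable M"
    and controls_paths: "AE \<omega> in M. 0 \<le> \<xi> 0 \<omega> \<and> mono_on {0..T} (\<lambda>t. \<xi> t \<omega>) \<and> cadlag_on T (\<lambda>t. \<xi> t \<omega>)"
    and controls_terminal: "integrable M (\<lambda>\<omega>. (\<xi> T \<omega>)\<^sup>2)"
proof -
  show ad: "\<xi> t \<in> borel_measurable (F t)" if "t \<in> {0..T}" for t
    using assms that unfolding monotone_controls_def by blast
  show "\<xi> t \<in> borel_measurable M" if "t \<in> {0..T}" for t
    by (rule measurable_from_subalg[OF subalgebra_F[OF that] ad[OF that]])
qed (use assms in \<open>auto simp: monotone_controls_def\<close>)

text \<open>A nonnegative non-decreasing path is largest at T, so the single condition at T bounds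
  all second moments uniformly, as \<open>ex_version\<close> requires.\<close>

lemma controls_square:
  assumes "\<xi> \<in> controls" "t \<in> {0..T}"
  shows "AE \<omega> in M. (\<xi> t \<omega>)\<^sup>2 \<le> (\<xi> T \<omega>)\<^sup>2"
    "integrable M (\<lambda>\<omega>. (\<xi> t \<omega>)\<^sup>2)" "(\<integral>\<omega>. (\<xi> t \<omega>)\<^sup>2 \<partial>M) \<le> (\<integral>\<omega>. (\<xi> T \<omega>)\<^sup>2 \<partial>M)"
    "integrable M (\<xi> t)"
proof -
  note [measurable] = controls_measurable[OF assms]
  show le: "AE \<omega> in M. (\<xi> t \<omega>)\<^sup>2 \<le> (\<xi> T \<omega>)\<^sup>2"
    using controls_paths[OF assms(1)]
  proof eventually_elim
    case (elim \<omega>)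
    then have "\<xi> 0 \<omega> \<le> \<xi> t \<omega>" "\<xi> t \<omega> \<le> \<xi> T \<omega>"
      using assms(2) T_pos by (auto elim!: mono_onD)
    then show ?case using elim by (intro power_mono) auto
  qed
  show sq: "integrable M (\<lambda>\<omega>. (\<xi> t \<omega>)\<^sup>2)"
    using le by (intro Bochner_Integration.integrable_bound[OF controls_terminal[OF assms(1)]]) auto
  show "(\<integral>\<omega>. (\<xi> t \<omega>)\<^sup>2 \<partial>M) \<le> (\<integral>\<omega>. (\<xi> T \<omega>)\<^sup>2 \<partial>M)"
    by (rule integral_mono_AE[OF sq controls_terminal[OF assms(1)] le])
  show "integrable M (\<xi> t)" by (rule square_integrable_imp_integrable[OF _ sq]) simp
qed

lemma ex_version_control:
  assumes "\<xi> \<in> controls" shows "\<exists>h. version \<xi> h"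
proof (rule ex_version)
  show "AE \<omega> in M. \<forall>t\<in>{0..<T}. ((\<lambda>s. \<xi> s \<omega>) \<longlongrightarrow> \<xi> t \<omega>) (at_right t)"
    using controls_paths[OF assms] by eventually_elim (auto simp: cadlag_on_def)
qed (fact controls_measurable[OF assms] controls_square(2,3)[OF assms])+

lemma version_state:
  assumes "version W w" "version \<xi> h"
  shows "version (state \<xi>) (\<lambda>p. x + \<sigma> * w p - h p)"
proof -
  \<comment> \<open>The factors 1 and -1 present the state as two nested linear combinations, the
    shape produced by \<open>version_add\<close>.\<close>
  have "version (\<lambda>t \<omega>. 1 * (1 * x + \<sigma> * W t \<omega>) + (- 1) * \<xi> t \<omega>)
      (\<lambda>p. 1 * (1 * x + \<sigma> * w p) + (- 1) * h p)"
    by (intro version_add version_const assms)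
  then show ?thesis by (simp add: controlled_state_def[abs_def])
qed


section \<open>Admissible perturbations of a control\<close>

lemma controlsI:
  assumes "\<And>t. t \<in> {0..T} \<Longrightarrow> \<xi> t \<in> borel_measurable (F t)"
    and "AE \<omega> in M. 0 \<le> \<xi> 0 \<omega> \<and> mono_on {0..T} (\<lambda>t. \<xi> t \<omega>) \<and> cadlag_on T (\<lambda>t. \<xi> t \<omega>)"
    and "integrable M (\<lambda>\<omega>. (\<xi> T \<omega>)\<^sup>2)"
  shows "\<xi> \<in> controls"
  using assms unfolding monotone_controls_def by blast

lemma controls_combination:
  assumes \<xi>: "\<xi> \<in> controls" and \<eta>: "\<eta> \<in> controls" and ab: "0 \<le> a" "0 \<le> b"
  shows "(\<lambda>t \<omega>. a * \<xi> t \<omega> + b * \<eta> t \<omega>) \<in> controls"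
proof (rule controlsI)
  fix t assume "t \<in> {0..T}"
  then show "(\<lambda>\<omega>. a * \<xi> t \<omega> + b * \<eta> t \<omega>) \<in> borel_measurable (F t)"
    using controls_adapted[OF \<xi>] controls_adapted[OF \<eta>] by simp
next
  show "AE \<omega> in M. 0 \<le> a * \<xi> 0 \<omega> + b * \<eta> 0 \<omega> \<and> mono_on {0..T} (\<lambda>t. a * \<xi> t \<omega> + b * \<eta> t \<omega>) \<and>
      cadlag_on T (\<lambda>t. a * \<xi> t \<omega> + b * \<eta> t \<omega>)"
    using controls_paths[OF \<xi>] controls_paths[OF \<eta>]
  proof eventually_elim
    case (elim \<omega>)
    have "mono_on {0..T} (\<lambda>t. a * \<xi> t \<omega> + b * \<eta> t \<omega>)"
    proof (rule mono_onI)
      fix s t assume "s \<in> {0..T}" "t \<in> {0..T}" "s \<le> t"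
      then have "\<xi> s \<omega> \<le> \<xi> t \<omega>" "\<eta> s \<omega> \<le> \<eta> t \<omega>" using elim by (auto elim!: mono_onD)
      then show "a * \<xi> s \<omega> + b * \<eta> s \<omega> \<le> a * \<xi> t \<omega> + b * \<eta> t \<omega>"
        using ab by (intro add_mono mult_left_mono) auto
    qed
    then show ?case using elim ab by (auto intro: cadlag_on_combination)
  qed
  show "integrable M (\<lambda>\<omega>. (a * \<xi> T \<omega> + b * \<eta> T \<omega>)\<^sup>2)"
    using T_pos by (intro integrable_square_add controls_terminal controls_measurable \<xi> \<eta>) auto
qed

definition stopped :: "real \<Rightarrow> (real \<Rightarrow> 'a \<Rightarrow> real) \<Rightarrow> real \<Rightarrow> 'a \<Rightarrow> real" where
  "stopped b \<xi> t \<omega> = \<xi> (min t b) \<omega>"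

lemma stopped_adapted:
  assumes \<xi>: "\<xi> \<in> controls" and b: "b \<in> {0..T}" and t: "t \<in> {0..T}"
  shows "stopped b \<xi> t \<in> borel_measurable (F t)"
proof -
  have "\<xi> (min t b) \<in> borel_measurable (F (min t b))"
    by (rule controls_adapted[OF \<xi>]) (use b t in auto)
  then have "\<xi> (min t b) \<in> borel_measurable (F t)"
    by (rule measurable_from_subalg[rotated]) (rule F_mono, use b t in auto)
  then show ?thesis by (simp add: stopped_def[abs_def])
qed

lemma stopped_controls:
  assumes \<xi>: "\<xi> \<in> controls" and b: "b \<in> {0..T}"
  shows "stopped b \<xi> \<in> controls"
proof (rule controlsI)
  show "AE \<omega> in M. 0 \<le> stopped b \<xi> 0 \<omega> \<and> mono_on {0..T} (\<lambda>t. stopped b \<xi> t \<omega>) \<and>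
      cadlag_on T (\<lambda>t. stopped b \<xi> t \<omega>)"
    using controls_paths[OF \<xi>]
  proof eventually_elim
    case (elim \<omega>)
    have "mono_on {0..T} (\<lambda>t. \<xi> (min t b) \<omega>)"
      by (rule mono_onI) (use b elim in \<open>auto elim!: mono_onD\<close>)
    with elim b show ?case by (auto simp: stopped_def intro: cadlag_on_stopped)
  qed
  show "integrable M (\<lambda>\<omega>. (stopped b \<xi> T \<omega>)\<^sup>2)"
    using controls_square(2)[OF \<xi> b] b by (simp add: stopped_def min_absorb2)
qed (rule stopped_adapted[OF assms])

text \<open>What remains is the increment of the control after \<open>b\<close>: zero up to
  \<open>b\<close>, then \<xi>_t - \<xi>_b, again non-decreasing and nonnegative. This makes the
  stopped path a direction that may also be subtracted.\<close>

lemma minus_stopped_controls: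
  assumes \<xi>: "\<xi> \<in> controls" and b: "b \<in> {0..T}"
  shows "(\<lambda>t \<omega>. 1 * \<xi> t \<omega> + (- 1) * stopped b \<xi> t \<omega>) \<in> controls"
proof (rule controlsI)
  fix t assume t: "t \<in> {0..T}"
  show "(\<lambda>\<omega>. 1 * \<xi> t \<omega> + (- 1) * stopped b \<xi> t \<omega>) \<in> borel_measurable (F t)"
    using controls_adapted[OF \<xi> t] stopped_adapted[OF \<xi> b t] by simp
next
  show "AE \<omega> in M. 0 \<le> 1 * \<xi> 0 \<omega> + (- 1) * stopped b \<xi> 0 \<omega> \<and>
      mono_on {0..T} (\<lambda>t. 1 * \<xi> t \<omega> + (- 1) * stopped b \<xi> t \<omega>) \<and>
      cadlag_on T (\<lambda>t. 1 * \<xi> t \<omega> + (- 1) * stopped b \<xi> t \<omega>)"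
    using controls_paths[OF \<xi>]
  proof eventually_elim
    case (elim \<omega>)
    then have mono: "\<xi> s \<omega> \<le> \<xi> t \<omega>" if "s \<le> t" "0 \<le> s" "t \<le> T" for s t
      using that by (auto elim!: mono_onD)
    have "mono_on {0..T} (\<lambda>t. 1 * \<xi> t \<omega> + (- 1) * stopped b \<xi> t \<omega>)"
    proof (rule mono_onI)
      fix s t assume "s \<in> {0..T}" "t \<in> {0..T}" "s \<le> t"
      then show "1 * \<xi> s \<omega> + (- 1) * stopped b \<xi> s \<omega> \<le> 1 * \<xi> t \<omega> + (- 1) * stopped b \<xi> t \<omega>"
        \<comment> \<open>If s \<le> b < t, only the increment from \<open>b\<close> to
          \<open>t\<close> matters; if both times exceed \<open>b\<close>, the value at
          \<open>b\<close> cancels.\<close>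
        using mono[of b t] mono[of s t] b by (auto simp: stopped_def min_def)
    qed
    moreover have "cadlag_on T (\<lambda>t. 1 * \<xi> t \<omega> + (- 1) * stopped b \<xi> t \<omega>)"
      unfolding stopped_def using elim b by (intro cadlag_on_combination cadlag_on_stopped) auto
    ultimately show ?case using b by (auto simp: stopped_def)
  qed
  have "T \<in> {0..T}" using T_pos by simp
  then show "integrable M (\<lambda>\<omega>. (1 * \<xi> T \<omega> + (- 1) * stopped b \<xi> T \<omega>)\<^sup>2)"
    by (intro integrable_square_add controls_terminal controls_measurable \<xi> stopped_controls b)
qed

text \<open>The total coefficient of -\<theta>X in the running cost: the square contributes \<alpha>
  and the linear term \<alpha>(1 - \<alpha>).\<close>

definition \<beta> :: real where "\<beta> = \<alpha> * (2 - \<alpha>)"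

text \<open>Integration by parts followed by Fubini. The terminal value stays outside the product
  integral because the time T is null for \<open>D\<close>. Integrability is claimed as well, since
  an integral that does not exist has the default value 0 and the equation alone would not permit
  splitting it.\<close>

lemma mfg_cost_eq:
  assumes \<eta>: "\<eta> \<in> controls" and h: "version \<eta> h" and g: "version (state \<eta>) g"
    and \<theta>: "\<theta> \<in> borel_measurable D" "integrable D (\<lambda>t. (\<theta> t)\<^sup>2)"
  shows "integrable P (\<lambda>p. 1/2 * (g p)\<^sup>2 - \<beta> * (\<theta> (fst p) * g p) + 1/2 * \<alpha>\<^sup>2 * (\<theta> (fst p))\<^sup>2 + K * \<rho> * h p)"
    and "mfg_cost M T W \<sigma> \<rho> K \<alpha> x \<eta> \<theta> =
      (\<integral>p. 1/2 * (g p)\<^sup>2 - \<beta> * (\<theta> (fst p) * g p) + 1/2 * \<alpha>\<^sup>2 * (\<theta> (fst p))\<^sup>2 + K * \<rho> * h p \<partial>P)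
      + K * exp (- \<rho> * T) * (\<integral>\<omega>. \<eta> T \<omega> \<partial>M)"
proof -
  note [measurable] = version_measurable[OF h] version_measurable[OF g] \<theta>(1)
  have \<theta>2: "integrable P (\<lambda>p. (\<theta> (fst p))\<^sup>2)"
    using integral_lift_time(1)[of "\<lambda>t. (\<theta> t)\<^sup>2"] \<theta> by simp
  define c where "c p = 1/2 * (g p)\<^sup>2 - \<beta> * (\<theta> (fst p) * g p) + 1/2 * \<alpha>\<^sup>2 * (\<theta> (fst p))\<^sup>2" for p
  define q where "q p = c p + K * \<rho> * h p" for p
  have c_int: "integrable P c"
    unfolding c_def[abs_def] using \<theta>2 version_square_integrable[OF g]
    by (intro Bochner_Integration.integrable_add Bochner_Integration.integrable_diff
          integrable_mult_right integrable_mult_square) auto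
  have h_int: "integrable P h" by (rule version_integrable[OF h])
  have q_int: "integrable P q" unfolding q_def[abs_def] using c_int h_int by simp
  then show "integrable P (\<lambda>p. 1/2 * (g p)\<^sup>2 - \<beta> * (\<theta> (fst p) * g p) + 1/2 * \<alpha>\<^sup>2 * (\<theta> (fst p))\<^sup>2 + K * \<rho> * h p)"
    unfolding q_def[abs_def] c_def .
  have [measurable]: "c \<in> borel_measurable P" using c_int by auto
  have c_eq: "1 / 2 * (y - \<alpha> * \<theta> t)\<^sup>2 - \<alpha> * (1 - \<alpha>) * \<theta> t * y =
      1/2 * y\<^sup>2 - \<beta> * (\<theta> t * y) + 1/2 * \<alpha>\<^sup>2 * (\<theta> t)\<^sup>2" for y t
    by (simp add: \<beta>_def power2_eq_square algebra_simps)
  have T: "T \<in> {0..T}" using T_pos by simp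
  have \<eta>T: "integrable M (\<eta> T)" by (rule controls_square(4)[OF \<eta> T])
  let ?cost = "\<lambda>\<omega>. (LINT t:{0..T}|lborel. exp (- \<rho> * t) *
            (1 / 2 * (state \<eta> t \<omega> - \<alpha> * \<theta> t)\<^sup>2 - \<alpha> * (1 - \<alpha>) * \<theta> t * state \<eta> t \<omega>))
        + K * stieltjes_integral T (\<lambda>t. exp (- \<rho> * t)) (\<lambda>t. \<eta> t \<omega>)"
  let ?R = "\<lambda>\<omega>. (\<integral>t. q (t, \<omega>) \<partial>D) + K * exp (- \<rho> * T) * \<eta> T \<omega>"
  have c_sec: "AE \<omega> in M. integrable D (\<lambda>t. c (t, \<omega>))" "AE \<omega> in M. integrable D (\<lambda>t. h (t, \<omega>))"
    using P.AE_integrable_snd[of "\<lambda>t \<omega>. c (t, \<omega>)"] P.AE_integrable_snd[of "\<lambda>t \<omega>. h (t, \<omega>)"]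
      c_int h_int by simp_all
  have R_int: "integrable M (\<lambda>\<omega>. \<integral>t. q (t, \<omega>) \<partial>D)"
    using P.integrable_snd[of "\<lambda>t \<omega>. q (t, \<omega>)"] q_int by simp
  have "AE \<omega> in M. ?cost \<omega> = ?R \<omega>"
    using version_AE[OF h] version_AE[OF g] controls_paths[OF \<eta>] c_sec AE_space
  proof eventually_elim
    case (elim \<omega>)
    have "(\<lambda>t. c (t, \<omega>)) \<in> borel_measurable D" using elim(4) by auto
    then have "(\<lambda>t. c (t, \<omega>)) \<in> borel_measurable (restrict_space borel {0..T})"
      by (simp cong: measurable_cong_sets add: sets_discounted_time)
    then have "(\<integral>t. c (t, \<omega>) \<partial>D) = (LINT t:{0..T}|lborel. exp (- \<rho> * t) * c (t, \<omega>))"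
      by (rule integral_discounted_time[symmetric])
    also have "\<dots> = (LINT t:{0..T}|lborel. exp (- \<rho> * t) *
            (1 / 2 * (state \<eta> t \<omega> - \<alpha> * \<theta> t)\<^sup>2 - \<alpha> * (1 - \<alpha>) * \<theta> t * state \<eta> t \<omega>))"
      using elim(2) unfolding c_eq by (intro set_lebesgue_integral_cong) (auto simp: c_def)
    finally have 1: "(LINT t:{0..T}|lborel. exp (- \<rho> * t) *
            (1 / 2 * (state \<eta> t \<omega> - \<alpha> * \<theta> t)\<^sup>2 - \<alpha> * (1 - \<alpha>) * \<theta> t * state \<eta> t \<omega>))
        = (\<integral>t. c (t, \<omega>) \<partial>D)" ..
    have "(\<integral>t. \<eta> t \<omega> \<partial>D) = (\<integral>t. h (t, \<omega>) \<partial>D)"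
      using elim(1) by (intro Bochner_Integration.integral_cong) auto
    then have 2: "stieltjes_integral T (\<lambda>t. exp (- \<rho> * t)) (\<lambda>t. \<eta> t \<omega>)
        = exp (- \<rho> * T) * \<eta> T \<omega> + \<rho> * (\<integral>t. h (t, \<omega>) \<partial>D)"
      using elim(3) by (subst stieltjes_integral_by_parts[OF T_pos \<rho>_pos]) (auto simp: cadlag_on_def)
    have 3: "(\<integral>t. q (t, \<omega>) \<partial>D) = (\<integral>t. c (t, \<omega>) \<partial>D) + K * \<rho> * (\<integral>t. h (t, \<omega>) \<partial>D)"
      unfolding q_def using elim(4,5) by simp
    show ?case unfolding 1 2 3 by (simp add: algebra_simps)
  qed
  \<comment> \<open>The original integrand has not been shown measurable; completeness allows
    replacing it by \<open>?R\<close> all the same.\<close>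
  then have "mfg_cost M T W \<sigma> \<rho> K \<alpha> x \<eta> \<theta> = (\<integral>\<omega>. ?R \<omega> \<partial>M)"
    unfolding mfg_cost_def using R_int \<eta>T by (intro integral_cong_AE_complete) auto
  also have "\<dots> = (\<integral>\<omega>. \<integral>t. q (t, \<omega>) \<partial>D \<partial>M) + K * exp (- \<rho> * T) * (\<integral>\<omega>. \<eta> T \<omega> \<partial>M)"
    using R_int \<eta>T by simp
  also have "(\<integral>\<omega>. \<integral>t. q (t, \<omega>) \<partial>D \<partial>M) = integral\<^sup>L P q"
    using P.integral_snd[of "\<lambda>t \<omega>. q (t, \<omega>)"] q_int by simp
  finally show "mfg_cost M T W \<sigma> \<rho> K \<alpha> x \<eta> \<theta> =
      (\<integral>p. 1/2 * (g p)\<^sup>2 - \<beta> * (\<theta> (fst p) * g p) + 1/2 * \<alpha>\<^sup>2 * (\<theta> (fst p))\<^sup>2 + K * \<rho> * h p \<partial>P)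
      + K * exp (- \<rho> * T) * (\<integral>\<omega>. \<eta> T \<omega> \<partial>M)"
    unfolding q_def c_def .
qed

section \<open>First variation of the cost at a solution\<close>

abbreviation solution :: "(real \<Rightarrow> 'a \<Rightarrow> real) \<Rightarrow> (real \<Rightarrow> real) \<Rightarrow> bool" where
  "solution \<equiv> mfg_solution M F T W \<sigma> \<rho> K \<alpha> x"

lemma
  assumes "solution \<xi> \<theta>"
  shows solution_controls: "\<xi> \<in> controls"
    and solution_optimal: "\<And>\<eta>. \<eta> \<in> controls \<Longrightarrow>
      mfg_cost M T W \<sigma> \<rho> K \<alpha> x \<xi> \<theta> \<le> mfg_cost M T W \<sigma> \<rho> K \<alpha> x \<eta> \<theta>"
    and solution_mean: "\<And>t. t \<in> {0..T} \<Longrightarrow> \<theta> t = (\<integral>\<omega>. state \<xi> t \<omega> \<partial>M)"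
  using assms unfolding mfg_solution_def by blast+

text \<open>The derivative of the cost along the segment from \<open>\<xi>\<close> to
  \<open>\<eta>\<close>, which stays admissible by convexity, is nonnegative at its minimizing end.
  The mean-field function is frozen while the control varies. Moving the control by
  \<open>k - h\<close> moves the state by \<open>h - k\<close>, hence the sign of the first
  product.\<close>

lemma variational_inequality:
  assumes sol: "solution \<xi> \<theta>" and \<eta>: "\<eta> \<in> controls"
    and w: "version W w" and h: "version \<xi> h" and k: "version \<eta> k"
    and g_def: "g = (\<lambda>p. x + \<sigma> * w p - h p)"
  shows "integrable P (\<lambda>p. (g p - \<beta> * \<theta> (fst p)) * (h p - k p) + K * \<rho> * (k p - h p))"
    and "0 \<le> (\<integral>p. (g p - \<beta> * \<theta> (fst p)) * (h p - k p) + K * \<rho> * (k p - h p) \<partial>P)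
      + K * exp (- \<rho> * T) * ((\<integral>\<omega>. \<eta> T \<omega> \<partial>M) - (\<integral>\<omega>. \<xi> T \<omega> \<partial>M))"
proof -
  note \<xi> = solution_controls[OF sol]
  have g: "version (state \<xi>) g" unfolding g_def by (rule version_state[OF w h])
  have \<theta>: "\<theta> \<in> borel_measurable D" "integrable D (\<lambda>t. (\<theta> t)\<^sup>2)"
    by (rule version_mean[OF g], erule solution_mean[OF sol])+
  note [measurable] = version_measurable[OF h] version_measurable[OF g] version_measurable[OF k] \<theta>(1)
  have \<theta>2: "integrable P (\<lambda>p. (\<theta> (fst p))\<^sup>2)"
    using integral_lift_time(1)[of "\<lambda>t. (\<theta> t)\<^sup>2"] \<theta> by simp
  have d2: "integrable P (\<lambda>p. (k p - h p)\<^sup>2)" "integrable P (\<lambda>p. (h p - k p)\<^sup>2)"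
    using integrable_square_add[of k P h 1 "-1"] integrable_square_add[of h P k 1 "-1"]
      version_square_integrable[OF h] version_square_integrable[OF k] by simp_all
  have y2: "integrable P (\<lambda>p. (g p - \<beta> * \<theta> (fst p))\<^sup>2)"
    using integrable_square_add[of g P "\<lambda>p. \<theta> (fst p)" 1 "-\<beta>"]
      version_square_integrable[OF g] \<theta>2 by simp
  let ?a = "\<lambda>p. (g p - \<beta> * \<theta> (fst p)) * (h p - k p) + K * \<rho> * (k p - h p)"
  let ?q = "\<lambda>p. 1/2 * (g p)\<^sup>2 - \<beta> * (\<theta> (fst p) * g p) + 1/2 * \<alpha>\<^sup>2 * (\<theta> (fst p))\<^sup>2 + K * \<rho> * h p"
  show a_int: "integrable P ?a"
    using y2 d2 version_integrable[OF h] version_integrable[OF k]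
    by (intro Bochner_Integration.integrable_add integrable_mult_square) auto
  have T: "T \<in> {0..T}" using T_pos by simp
  let ?E = "(\<integral>\<omega>. \<eta> T \<omega> \<partial>M) - (\<integral>\<omega>. \<xi> T \<omega> \<partial>M)"
  define a where "a p = ?a p" for p
  define q where "q p = ?q p" for p
  have a_int': "integrable P a" using a_int unfolding a_def .
  have q_int: "integrable P q" using mfg_cost_eq(1)[OF \<xi> h g \<theta>] unfolding q_def .
  have "0 \<le> integral\<^sup>L P a + K * exp (- \<rho> * T) * ?E"
  proof (rule nonneg_of_quadratic_perturbation)
    fix e :: real assume e: "0 < e" "e \<le> 1"
    let ?\<eta> = "\<lambda>t \<omega>. (1 - e) * \<xi> t \<omega> + e * \<eta> t \<omega>"
    let ?k = "\<lambda>p. (1 - e) * h p + e * k p"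
    let ?g = "\<lambda>p. x + \<sigma> * w p - ?k p"
    have c: "?\<eta> \<in> controls" using e by (intro controls_combination \<xi> \<eta>) auto
    have vk: "version ?\<eta> ?k" by (rule version_add[OF h k])
    note cost_\<eta> = mfg_cost_eq[OF c vk version_state[OF w vk] \<theta>]
    note cost_\<xi> = mfg_cost_eq[OF \<xi> h g \<theta>]
    \<comment> \<open>The expansion in \<open>e\<close> is exact: the control enters quadratically
      through the state and linearly through its cost.\<close>
    have expand: "1/2 * (?g p)\<^sup>2 - \<beta> * (\<theta> (fst p) * ?g p) + 1/2 * \<alpha>\<^sup>2 * (\<theta> (fst p))\<^sup>2 + K * \<rho> * ?k p
        = q p + e * a p + e\<^sup>2 * (1/2) * (k p - h p)\<^sup>2" for p
    proof -
      have "?g p = g p - e * (k p - h p)" by (simp add: g_def algebra_simps)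
      moreover have "?k p = h p + e * (k p - h p)" by (simp add: algebra_simps)
      ultimately show ?thesis unfolding q_def a_def by algebra
    qed
    have "(\<integral>p. q p + e * a p + e\<^sup>2 * (1/2) * (k p - h p)\<^sup>2 \<partial>P)
        = (\<integral>p. q p + e * a p \<partial>P) + (\<integral>p. e\<^sup>2 * (1/2) * (k p - h p)\<^sup>2 \<partial>P)"
      using q_int a_int' d2(1)
      by (intro Bochner_Integration.integral_add Bochner_Integration.integrable_add integrable_mult_right)
    also have "(\<integral>p. q p + e * a p \<partial>P) = integral\<^sup>L P q + (\<integral>p. e * a p \<partial>P)"
      using q_int a_int' by (intro Bochner_Integration.integral_add integrable_mult_right)
    finally have 1: "(\<integral>p. q p + e * a p + e\<^sup>2 * (1/2) * (k p - h p)\<^sup>2 \<partial>P)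
        = integral\<^sup>L P q + e * integral\<^sup>L P a + e\<^sup>2 * (1/2) * (\<integral>p. (k p - h p)\<^sup>2 \<partial>P)"
      by simp
    have 2: "(\<integral>\<omega>. ?\<eta> T \<omega> \<partial>M) = (\<integral>\<omega>. \<xi> T \<omega> \<partial>M) + e * ?E"
      using controls_square(4)[OF \<xi> T] controls_square(4)[OF \<eta> T] by (simp add: algebra_simps)
    have "mfg_cost M T W \<sigma> \<rho> K \<alpha> x \<xi> \<theta> \<le> mfg_cost M T W \<sigma> \<rho> K \<alpha> x ?\<eta> \<theta>"
      by (rule solution_optimal[OF sol c])
    moreover have "mfg_cost M T W \<sigma> \<rho> K \<alpha> x \<xi> \<theta>
        = integral\<^sup>L P q + K * exp (- \<rho> * T) * (\<integral>\<omega>. \<xi> T \<omega> \<partial>M)"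
      unfolding q_def by (rule cost_\<xi>(2))
    moreover have "mfg_cost M T W \<sigma> \<rho> K \<alpha> x ?\<eta> \<theta>
        = integral\<^sup>L P q + e * integral\<^sup>L P a + e\<^sup>2 * (1/2) * (\<integral>p. (k p - h p)\<^sup>2 \<partial>P)
          + K * exp (- \<rho> * T) * ((\<integral>\<omega>. \<xi> T \<omega> \<partial>M) + e * ?E)"
      unfolding cost_\<eta>(2) by (simp only: expand 1 2)
    ultimately have "integral\<^sup>L P q + K * exp (- \<rho> * T) * (\<integral>\<omega>. \<xi> T \<omega> \<partial>M)
        \<le> integral\<^sup>L P q + e * integral\<^sup>L P a + e\<^sup>2 * (1/2) * (\<integral>p. (k p - h p)\<^sup>2 \<partial>P)
          + K * exp (- \<rho> * T) * ((\<integral>\<omega>. \<xi> T \<omega> \<partial>M) + e * ?E)"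
      by (simp only:)
    then show "0 \<le> e * (integral\<^sup>L P a + K * exp (- \<rho> * T) * ?E) + e\<^sup>2 * (1/2 * (\<integral>p. (k p - h p)\<^sup>2 \<partial>P))"
      by (simp add: algebra_simps)
  qed
  then show "0 \<le> integral\<^sup>L P ?a + K * exp (- \<rho> * T) * ?E" unfolding a_def .
qed


section \<open>No jump at the terminal time\<close>

lemma terminal_time_mem: "T \<in> {0..T}"
  using T_pos by simp

lemma version_AE_eq:
  assumes g: "version Z g" and g': "version Z' g'"
    and eq: "AE t in D. AE \<omega> in M. Z t \<omega> = Z' t \<omega>"
  shows "AE p in P. g p = g' p"
proof (rule P.AE_pair_measure)
  note [measurable] = version_measurable[OF g] version_measurable[OF g']
  show "{p \<in> space P. g p = g' p} \<in> sets P" by measurable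
  have "AE t in D. t \<in> {0..T}" by (intro AE_I2) simp
  with eq show "AE t in D. AE \<omega> in M. g (t, \<omega>) = g' (t, \<omega>)"
  proof eventually_elim
    case (elim t)
    show ?case using elim(1) version_section(2)[OF g elim(2)] version_section(2)[OF g' elim(2)]
      by eventually_elim simp
  qed
qed

lemma AE_time_neq: "AE t in D. t \<noteq> b"
  unfolding AE_discounted_time using AE_lborel_singleton[of b] by eventually_elim simp

lemma version_deterministic:
  assumes "f \<in> borel_measurable D" "integrable D (\<lambda>t. (f t)\<^sup>2)"
  shows "version (\<lambda>t \<omega>. f t) (\<lambda>p. f (fst p))"
proof -
  note [measurable] = assms(1)
  show ?thesis unfolding version_def
    using integral_lift_time(1)[of "\<lambda>t. (f t)\<^sup>2"] assms by auto
qed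

text \<open>Deleting the jump of a control at time \<open>T\<close> changes the state only at a single time.\<close>

definition without_terminal_jump :: "(real \<Rightarrow> 'a \<Rightarrow> real) \<Rightarrow> real \<Rightarrow> 'a \<Rightarrow> real" where
  "without_terminal_jump \<xi> t \<omega> =
    (if t < T then \<xi> t \<omega> else lim (\<lambda>n. \<xi> (T - T / (real n + 1)) \<omega>))"

lemma without_terminal_jump_path:
  assumes nonneg: "0 \<le> \<xi> 0 \<omega>" and mono: "mono_on {0..T} (\<lambda>t. \<xi> t \<omega>)"
    and cadlag: "cadlag_on T (\<lambda>t. \<xi> t \<omega>)"
  shows "((\<lambda>t. \<xi> t \<omega>) \<longlongrightarrow> without_terminal_jump \<xi> T \<omega>) (at_left T)"
    and "\<And>t. t \<in> {0..<T} \<Longrightarrow> \<xi> t \<omega> \<le> without_terminal_jump \<xi> T \<omega>"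
    and "without_terminal_jump \<xi> T \<omega> \<le> \<xi> T \<omega>"
    and "mono_on {0..T} (\<lambda>t. without_terminal_jump \<xi> t \<omega>)"
    and "cadlag_on T (\<lambda>t. without_terminal_jump \<xi> t \<omega>)"
proof -
  obtain l where l: "((\<lambda>t. \<xi> t \<omega>) \<longlongrightarrow> l) (at_left T)"
    using cadlag T_pos unfolding cadlag_on_def by force
  \<comment> \<open>The left limit is taken along a sequence so that it is measurable at time T. The
    sequence starts at time 0 and stays in [0,T), where the control is adapted.\<close>
  have "filterlim (\<lambda>n. T - T / (real n + 1)) (at_left T) sequentially"
  proof (unfold filterlim_at, intro conjI)
    have "(\<lambda>n. T - T * (1 / real (Suc n))) \<longlonglongrightarrow> T - T * 0"
      by (intro tendsto_intros LIMSEQ_Suc[OF lim_1_over_n])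
    then show "(\<lambda>n. T - T / (real n + 1)) \<longlonglongrightarrow> T" by (simp add: add.commute)
    show "\<forall>\<^sub>F n in sequentially. T - T / (real n + 1) \<in> {..<T} \<and> T - T / (real n + 1) \<noteq> T" using T_pos by simp
  qed
  from filterlim_compose[OF l this]
  have "(\<lambda>n. \<xi> (T - T / (real n + 1)) \<omega>) \<longlonglongrightarrow> l" .
  then have T_eq: "without_terminal_jump \<xi> T \<omega> = l"
    by (simp add: without_terminal_jump_def limI)
  show "((\<lambda>t. \<xi> t \<omega>) \<longlongrightarrow> without_terminal_jump \<xi> T \<omega>) (at_left T)" using l T_eq by simp
  show le: "\<xi> t \<omega> \<le> without_terminal_jump \<xi> T \<omega>" if t: "t \<in> {0..<T}" for t
    unfolding T_eq
  proof (rule tendsto_lowerbound[OF l])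
    show "\<forall>\<^sub>F s in at_left T. \<xi> t \<omega> \<le> \<xi> s \<omega>"
      by (rule eventually_at_leftI[of t T]) (use t mono in \<open>auto elim!: mono_onD\<close>)
  qed simp
  show "without_terminal_jump \<xi> T \<omega> \<le> \<xi> T \<omega>"
    unfolding T_eq
  proof (rule tendsto_upperbound[OF l])
    show "\<forall>\<^sub>F s in at_left T. \<xi> s \<omega> \<le> \<xi> T \<omega>"
      by (rule eventually_at_leftI[of 0 T]) (use T_pos mono in \<open>auto elim!: mono_onD\<close>)
  qed simp
  show "mono_on {0..T} (\<lambda>t. without_terminal_jump \<xi> t \<omega>)"
  proof (rule mono_onI)
    fix s t assume st: "s \<in> {0..T}" "t \<in> {0..T}" "s \<le> t"
    show "without_terminal_jump \<xi> s \<omega> \<le> without_terminal_jump \<xi> t \<omega>"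
    proof (cases "t < T")
      case True
      then show ?thesis using st mono by (auto simp: without_terminal_jump_def elim!: mono_onD)
    next
      case False
      then have "t = T" using st by simp
      show ?thesis
      proof (cases "s < T")
        case True
        then show ?thesis using le[of s] st \<open>t = T\<close> by (simp add: without_terminal_jump_def)
      qed (use st \<open>t = T\<close> in simp)
    qed
  qed
  show "cadlag_on T (\<lambda>t. without_terminal_jump \<xi> t \<omega>)"
    unfolding cadlag_on_def
  proof (intro conjI ballI)
    fix t assume t: "t \<in> {0..<T}"
    then have "\<forall>\<^sub>F s in at_right t. \<xi> s \<omega> = without_terminal_jump \<xi> s \<omega>"
      by (intro eventually_at_rightI[of t T]) (auto simp: without_terminal_jump_def)
    from Lim_transform_eventually[OF _ this, of "\<xi> t \<omega>"]
    show "((\<lambda>s. without_terminal_jump \<xi> s \<omega>) \<longlongrightarrow> without_terminal_jump \<xi> t \<omega>) (at_right t)"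
      using cadlag t by (simp add: cadlag_on_def without_terminal_jump_def[of \<xi> t \<omega>])
  next
    fix t assume t: "t \<in> {0<..T}"
    then have ev: "\<forall>\<^sub>F s in at_left t. \<xi> s \<omega> = without_terminal_jump \<xi> s \<omega>"
      by (intro eventually_at_leftI[of 0 t]) (auto simp: without_terminal_jump_def)
    obtain l where "((\<lambda>s. \<xi> s \<omega>) \<longlongrightarrow> l) (at_left t)"
      using cadlag t unfolding cadlag_on_def by blast
    from Lim_transform_eventually[OF this ev]
    show "\<exists>l. ((\<lambda>s. without_terminal_jump \<xi> s \<omega>) \<longlongrightarrow> l) (at_left t)" by blast
  qed
qed

lemma without_terminal_jump_controls:
  assumes \<xi>: "\<xi> \<in> controls"
  shows "without_terminal_jump \<xi> \<in> controls"
proof (rule controlsI)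
  show ad: "without_terminal_jump \<xi> t \<in> borel_measurable (F t)" if t: "t \<in> {0..T}" for t
  proof (cases "t < T")
    case True
    then show ?thesis using controls_adapted[OF \<xi> t] by (simp add: without_terminal_jump_def[abs_def])
  next
    case False
    with t have "t = T" by simp
    have "\<xi> (T - T / (real n + 1)) \<in> borel_measurable (F T)" for n
    proof -
      have n: "0 \<le> T - T / (real n + 1)" "T - T / (real n + 1) \<le> T"
        using T_pos by (auto simp: field_simps)
      then have "\<xi> (T - T / (real n + 1)) \<in> borel_measurable (F (T - T / (real n + 1)))"
        by (intro controls_adapted[OF \<xi>]) auto
      then show ?thesis
        by (rule measurable_from_subalg[rotated]) (rule F_mono, use n in auto)
    qed
    then have "(\<lambda>\<omega>. lim (\<lambda>n. \<xi> (T - T / (real n + 1)) \<omega>)) \<in> borel_measurable (F T)"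
      by (rule borel_measurable_lim_metric)
    then show ?thesis using \<open>t = T\<close> by (simp add: without_terminal_jump_def[abs_def])
  qed
  show "AE \<omega> in M. 0 \<le> without_terminal_jump \<xi> 0 \<omega> \<and>
      mono_on {0..T} (\<lambda>t. without_terminal_jump \<xi> t \<omega>) \<and>
      cadlag_on T (\<lambda>t. without_terminal_jump \<xi> t \<omega>)"
    using controls_paths[OF \<xi>]
  proof eventually_elim
    case (elim \<omega>)
    then show ?case using T_pos without_terminal_jump_path(4,5)[of \<xi> \<omega>]
      by (simp add: without_terminal_jump_def[of \<xi> 0 \<omega>])
  qed
  show "integrable M (\<lambda>\<omega>. (without_terminal_jump \<xi> T \<omega>)\<^sup>2)"
  proof (rule Bochner_Integration.integrable_bound[OF controls_terminal[OF \<xi>]])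
    show "(\<lambda>\<omega>. (without_terminal_jump \<xi> T \<omega>)\<^sup>2) \<in> borel_measurable M"
      using measurable_from_subalg[OF subalgebra_F[OF terminal_time_mem] ad[OF terminal_time_mem]]
      by simp
    show "AE \<omega> in M. norm ((without_terminal_jump \<xi> T \<omega>)\<^sup>2) \<le> norm ((\<xi> T \<omega>)\<^sup>2)"
      using controls_paths[OF \<xi>]
    proof eventually_elim
      case (elim \<omega>)
      then have "\<xi> 0 \<omega> \<le> without_terminal_jump \<xi> T \<omega>" "without_terminal_jump \<xi> T \<omega> \<le> \<xi> T \<omega>"
        using T_pos without_terminal_jump_path(2,3)[of \<xi> \<omega>] by auto
      with elim show ?case by (auto intro!: power_mono)
    qed
  qed
qed

lemma solution_left_continuous_terminal:
  assumes sol: "solution \<xi> \<theta>"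
  shows "AE \<omega> in M. ((\<lambda>t. \<xi> t \<omega>) \<longlongrightarrow> \<xi> T \<omega>) (at_left T)"
proof -
  note \<xi> = solution_controls[OF sol]
  let ?\<eta> = "without_terminal_jump \<xi>"
  note \<eta> = without_terminal_jump_controls[OF \<xi>]
  obtain w h k where w: "version W w" and h: "version \<xi> h" and k: "version ?\<eta> k"
    using ex_version_brownian ex_version_control[OF \<xi>] ex_version_control[OF \<eta>] by blast
  note vi = variational_inequality[OF sol \<eta> w h k refl]
  have "AE p in P. h p = k p"
  proof (rule version_AE_eq[OF h k])
    have "AE t in D. t \<in> {0..T}" by (intro AE_I2) simp
    with AE_time_neq[of T] show "AE t in D. AE \<omega> in M. \<xi> t \<omega> = ?\<eta> t \<omega>"
      by eventually_elim (simp add: without_terminal_jump_def)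
  qed
  \<comment> \<open>Only the terminal term of the variational inequality survives. It forces the
    mean at T not to drop when the jump is removed, whereas pathwise the value at T can only
    drop.\<close>
  then have "AE p in P. (x + \<sigma> * w p - h p - \<beta> * \<theta> (fst p)) * (h p - k p) + K * \<rho> * (k p - h p) = 0"
    by eventually_elim simp
  then have "0 \<le> K * exp (- \<rho> * T) * ((\<integral>\<omega>. ?\<eta> T \<omega> \<partial>M) - (\<integral>\<omega>. \<xi> T \<omega> \<partial>M))"
    using vi(2) by (simp add: integral_eq_zero_AE)
  moreover have "0 < K * exp (- \<rho> * T)" using K_pos by simp
  ultimately have le: "(\<integral>\<omega>. \<xi> T \<omega> \<partial>M) \<le> (\<integral>\<omega>. ?\<eta> T \<omega> \<partial>M)"
    using mult_pos_neg[of "K * exp (- \<rho> * T)" "(\<integral>\<omega>. ?\<eta> T \<omega> \<partial>M) - (\<integral>\<omega>. \<xi> T \<omega> \<partial>M)"] by linarith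
  note int = controls_square(4)[OF \<xi> terminal_time_mem] controls_square(4)[OF \<eta> terminal_time_mem]
  have nonneg: "AE \<omega> in M. 0 \<le> \<xi> T \<omega> - ?\<eta> T \<omega>"
    using controls_paths[OF \<xi>] by eventually_elim (simp add: without_terminal_jump_path(3))
  have "(\<integral>\<omega>. \<xi> T \<omega> - ?\<eta> T \<omega> \<partial>M) = 0"
    using le int integral_nonneg_AE[OF nonneg] by simp
  then have "AE \<omega> in M. \<xi> T \<omega> - ?\<eta> T \<omega> = 0"
    using integral_nonneg_eq_0_iff_AE[OF _ nonneg] int by simp
  with controls_paths[OF \<xi>] show ?thesis
  proof eventually_elim
    case (elim \<omega>)
    then show ?case using without_terminal_jump_path(1)[of \<xi> \<omega>] by simp
  qed
qed

text \<open>\<open>a\<close> is the first variation of the running part in the direction of the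
  stopped path. That path ends at the value \<open>\<xi> b\<close>, which gives the terminal term.
  Testing with the sum and with the difference yields both signs.\<close>

lemma stopped_stationarity:
  assumes sol: "solution \<xi> \<theta>" and b: "b \<in> {0..T}"
    and w: "version W w" and h: "version \<xi> h" and z: "version (stopped b \<xi>) z"
  defines "a \<equiv> \<lambda>p. K * \<rho> * z p - (x + \<sigma> * w p - h p - \<beta> * \<theta> (fst p)) * z p"
  shows "integrable P a" "integral\<^sup>L P a + K * exp (- \<rho> * T) * (\<integral>\<omega>. \<xi> b \<omega> \<partial>M) = 0"
proof -
  note \<xi> = solution_controls[OF sol]
  note st = stopped_controls[OF \<xi> b]
  have plus: "(\<lambda>t \<omega>. 1 * \<xi> t \<omega> + 1 * stopped b \<xi> t \<omega>) \<in> controls"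
    by (rule controls_combination[OF \<xi> st]) auto
  note minus = minus_stopped_controls[OF \<xi> b]
  note vp = variational_inequality[OF sol plus w h version_add[OF h z] refl]
  note vm = variational_inequality[OF sol minus w h version_add[OF h z] refl]
  have ap: "(\<lambda>p. (x + \<sigma> * w p - h p - \<beta> * \<theta> (fst p)) * (h p - (1 * h p + 1 * z p))
      + K * \<rho> * (1 * h p + 1 * z p - h p)) = a"
    by (auto simp: a_def algebra_simps)
  have am: "(\<lambda>p. (x + \<sigma> * w p - h p - \<beta> * \<theta> (fst p)) * (h p - (1 * h p + (- 1) * z p))
      + K * \<rho> * (1 * h p + (- 1) * z p - h p)) = (\<lambda>p. - a p)"
    by (auto simp: a_def algebra_simps)
  show "integrable P a" using vp(1) unfolding ap .
  note int = controls_square(4)[OF \<xi> terminal_time_mem] controls_square(4)[OF st terminal_time_mem]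
  have sT: "(\<integral>\<omega>. stopped b \<xi> T \<omega> \<partial>M) = (\<integral>\<omega>. \<xi> b \<omega> \<partial>M)"
    using b by (simp add: stopped_def min_absorb2)
  have Ep: "(\<integral>\<omega>. 1 * \<xi> T \<omega> + 1 * stopped b \<xi> T \<omega> \<partial>M) - (\<integral>\<omega>. \<xi> T \<omega> \<partial>M) = (\<integral>\<omega>. \<xi> b \<omega> \<partial>M)"
    using int sT by simp
  have Em: "(\<integral>\<omega>. 1 * \<xi> T \<omega> + (- 1) * stopped b \<xi> T \<omega> \<partial>M) - (\<integral>\<omega>. \<xi> T \<omega> \<partial>M) = - (\<integral>\<omega>. \<xi> b \<omega> \<partial>M)"
    using int sT by simp
  have "0 \<le> integral\<^sup>L P a + K * exp (- \<rho> * T) * (\<integral>\<omega>. \<xi> b \<omega> \<partial>M)"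
    using vp(2) unfolding ap Ep .
  moreover have "0 \<le> (\<integral>p. - a p \<partial>P) + K * exp (- \<rho> * T) * (- (\<integral>\<omega>. \<xi> b \<omega> \<partial>M))"
    using vm(2) unfolding am Em .
  ultimately show "integral\<^sup>L P a + K * exp (- \<rho> * T) * (\<integral>\<omega>. \<xi> b \<omega> \<partial>M) = 0"
    by simp
qed

end

section \<open>Comparison of two solutions\<close>

locale two_solutions = mean_field_follower +
  fixes \<xi>1 \<xi>2 :: "real \<Rightarrow> 'a \<Rightarrow> real" and \<theta>1 \<theta>2 :: "real \<Rightarrow> real"
  assumes sol1: "solution \<xi>1 \<theta>1" and sol2: "solution \<xi>2 \<theta>2"
begin

abbreviation mean_gap :: "real \<Rightarrow> real" where "mean_gap t \<equiv> \<theta>1 t - \<theta>2 t"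

lemmas controls1 = solution_controls[OF sol1] and controls2 = solution_controls[OF sol2]

text \<open>The indices swap because the control is subtracted in the state; the initial value and
  the Brownian part are common to both solutions and cancel.\<close>

lemma mean_gap_eq:
  assumes t: "t \<in> {0..T}"
  shows "mean_gap t = (\<integral>\<omega>. \<xi>2 t \<omega> - \<xi>1 t \<omega> \<partial>M)"
    and "mean_gap t = (\<integral>\<omega>. \<xi>2 t \<omega> \<partial>M) - (\<integral>\<omega>. \<xi>1 t \<omega> \<partial>M)"
proof -
  have "integrable M (W t)"
    using brownian_moments[OF t] by (auto intro: square_integrable_imp_integrable)
  then show "mean_gap t = (\<integral>\<omega>. \<xi>2 t \<omega> \<partial>M) - (\<integral>\<omega>. \<xi>1 t \<omega> \<partial>M)"
    using solution_mean[OF sol1 t] solution_mean[OF sol2 t]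
      controls_square(4)[OF controls1 t] controls_square(4)[OF controls2 t]
    by (simp add: controlled_state_def)
  then show "mean_gap t = (\<integral>\<omega>. \<xi>2 t \<omega> - \<xi>1 t \<omega> \<partial>M)"
    using controls_square(4)[OF controls1 t] controls_square(4)[OF controls2 t] by simp
qed

lemma version_gap:
  assumes "version \<xi>1 h1" "version \<xi>2 h2"
  shows "version (\<lambda>t \<omega>. \<xi>2 t \<omega> - \<xi>1 t \<omega>) (\<lambda>p. h2 p - h1 p)"
  using version_add[OF assms(2,1), of 1 "-1"] by simp

lemma mean_gap_square_integrable:
  shows "mean_gap \<in> borel_measurable D" "integrable D (\<lambda>t. (mean_gap t)\<^sup>2)"
proof -
  obtain h1 h2 where "version \<xi>1 h1" "version \<xi>2 h2"
    using ex_version_control controls1 controls2 by blast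
  note v = version_gap[OF this]
  show "mean_gap \<in> borel_measurable D" "integrable D (\<lambda>t. (mean_gap t)\<^sup>2)"
    by (rule version_mean[OF v], erule mean_gap_eq(1))+
qed

text \<open>
  Adding the two variational inequalities gives
  \<open>E \<integral> (gap - mean_gap)\<^sup>2 + (1 - \<alpha>)\<^sup>2 \<integral> mean_gap\<^sup>2 \<le> 0\<close>, because \<open>1 - \<beta> = (1 - \<alpha>)\<^sup>2\<close>.
\<close>

lemma gap_eq_mean_gap_AE:
  assumes h1: "version \<xi>1 h1" and h2: "version \<xi>2 h2"
  shows "AE p in P. h2 p - h1 p = mean_gap (fst p) \<and> (1 - \<alpha>)\<^sup>2 * (mean_gap (fst p))\<^sup>2 = 0"
proof -
  obtain w where w: "version W w" using ex_version_brownian by blast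
  note v1 = variational_inequality[OF sol1 controls2 w h1 h2 refl]
  note v2 = variational_inequality[OF sol2 controls1 w h2 h1 refl]
  note m = mean_gap_square_integrable
  have cross: "integrable P (\<lambda>p. mean_gap (fst p) * (h2 p - h1 p))"
      "(\<integral>p. mean_gap (fst p) * (h2 p - h1 p) \<partial>P) = (\<integral>t. mean_gap t * mean_gap t \<partial>D)"
    by (rule integral_mean_mult[OF version_gap[OF h1 h2] _ m], erule mean_gap_eq(1))+
  have sq: "integrable P (\<lambda>p. (mean_gap (fst p))\<^sup>2)"
      "(\<integral>p. (mean_gap (fst p))\<^sup>2 \<partial>P) = (\<integral>t. (mean_gap t)\<^sup>2 \<partial>D)"
    using integral_lift_time[of "\<lambda>t. (mean_gap t)\<^sup>2"] m by auto
  define a1 where "a1 p = (x + \<sigma> * w p - h1 p - \<beta> * \<theta>1 (fst p)) * (h1 p - h2 p) + K * \<rho> * (h2 p - h1 p)" for p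
  define a2 where "a2 p = (x + \<sigma> * w p - h2 p - \<beta> * \<theta>2 (fst p)) * (h2 p - h1 p) + K * \<rho> * (h1 p - h2 p)" for p
  define c where "c p = mean_gap (fst p) * (h2 p - h1 p)" for p
  define q where "q p = (mean_gap (fst p))\<^sup>2" for p :: "real \<times> 'a"
  define s where "s p = (h2 p - h1 p - mean_gap (fst p))\<^sup>2 + (1 - \<alpha>)\<^sup>2 * (mean_gap (fst p))\<^sup>2" for p
  have int: "integrable P a1" "integrable P a2" "integrable P c" "integrable P q"
    using v1(1) v2(1) cross(1) sq(1) unfolding a1_def[abs_def] a2_def[abs_def] c_def[abs_def] q_def[abs_def]
    by auto
  \<comment> \<open>With d the gap and m its mean, a1 + a2 = -d^2 + \<beta> m d, since the control
    costs cancel. Eliminating d^2 leaves \<open>q\<close> and \<open>c\<close> with opposite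
    coefficients, and their integrals agree because m integrated against d sees only the mean of
    d.\<close>
  have s_eq: "s p = (2 - \<beta>) * q p - (2 - \<beta>) * c p - (a1 p + a2 p)" for p
    unfolding s_def q_def c_def a1_def a2_def \<beta>_def by algebra
  \<comment> \<open>The terminal terms of the two inequalities are negatives of each other.\<close>
  have "0 \<le> integral\<^sup>L P a1 + integral\<^sup>L P a2"
    using add_mono[OF v1(2) v2(2)] unfolding a1_def[symmetric] a2_def[symmetric]
    by (simp add: algebra_simps)
  moreover have "integral\<^sup>L P c = integral\<^sup>L P q"
    using cross(2) sq(2) unfolding c_def[abs_def] q_def[abs_def] by (simp add: power2_eq_square)
  moreover have "integral\<^sup>L P s = (2 - \<beta>) * integral\<^sup>L P q - (2 - \<beta>) * integral\<^sup>L P c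
      - (integral\<^sup>L P a1 + integral\<^sup>L P a2)"
    unfolding s_eq[abs_def] using int by simp
  ultimately have "integral\<^sup>L P s \<le> 0" by simp
  moreover have s_int: "integrable P s" unfolding s_eq[abs_def] using int by simp
  moreover have s_nonneg: "AE p in P. 0 \<le> s p" by (simp add: s_def)
  ultimately have "integral\<^sup>L P s = 0" using integral_nonneg_AE[OF s_nonneg] by simp
  then have "AE p in P. s p = 0"
    using integral_nonneg_eq_0_iff_AE[OF s_int s_nonneg] by simp
  then show ?thesis
  proof eventually_elim
    case (elim p)
    then show ?case unfolding s_def by (subst (asm) add_nonneg_eq_0_iff) auto
  qed
qed

text \<open>One good scenario \<open>\<omega>0\<close> is fixed and its gap path serves as the
  deterministic representative. Every other good scenario has the same gap at almost every time,
  hence at all times before T by right-continuity and at T by left-continuity. Averaging identifies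
  this path with the mean gap, which thereby inherits the regularity of a single path.\<close>

lemma gap_deterministic:
  shows "AE \<omega> in M. \<forall>t\<in>{0..T}. \<xi>2 t \<omega> - \<xi>1 t \<omega> = mean_gap t"
    and "\<And>t. t \<in> {0..<T} \<Longrightarrow> (mean_gap \<longlongrightarrow> mean_gap t) (at_right t)"
    and "(mean_gap \<longlongrightarrow> mean_gap T) (at_left T)"
proof -
  obtain h1 h2 where h1: "version \<xi>1 h1" and h2: "version \<xi>2 h2"
    using ex_version_control controls1 controls2 by blast
  note [measurable] = version_measurable[OF h1] version_measurable[OF h2] mean_gap_square_integrable(1)
  define good where "good \<omega> \<longleftrightarrow>
      (AE t in D. \<xi>2 t \<omega> - \<xi>1 t \<omega> = mean_gap t) \<and>
      (\<forall>t\<in>{0..<T}. ((\<lambda>s. \<xi>2 s \<omega> - \<xi>1 s \<omega>) \<longlongrightarrow> \<xi>2 t \<omega> - \<xi>1 t \<omega>) (at_right t)) \<and>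
      ((\<lambda>s. \<xi>2 s \<omega> - \<xi>1 s \<omega>) \<longlongrightarrow> \<xi>2 T \<omega> - \<xi>1 T \<omega>) (at_left T)" for \<omega>
  have "AE p in P. h2 (fst p, snd p) - h1 (fst p, snd p) = mean_gap (fst p)"
    using gap_eq_mean_gap_AE[OF h1 h2] by eventually_elim simp
  then have "AE t in D. AE \<omega> in M. h2 (t, \<omega>) - h1 (t, \<omega>) = mean_gap t"
    using P.AE_pair[of "\<lambda>p. h2 p - h1 p = mean_gap (fst p)"] by simp
  moreover have "{p \<in> space P. h2 (fst p, snd p) - h1 (fst p, snd p) = mean_gap (fst p)} \<in> sets P"
    by measurable
  \<comment> \<open>Exchanging the quantifiers makes the exceptional set of times depend on the
    scenario, so that the comparison can be made path by path.\<close>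
  ultimately have "AE \<omega> in M. AE t in D. h2 (t, \<omega>) - h1 (t, \<omega>) = mean_gap t"
    using P.AE_commute[of "\<lambda>t \<omega>. h2 (t, \<omega>) - h1 (t, \<omega>) = mean_gap t"] by simp
  with version_AE[OF h1] version_AE[OF h2] controls_paths[OF controls1] controls_paths[OF controls2]
    solution_left_continuous_terminal[OF sol1] solution_left_continuous_terminal[OF sol2]
  have good: "AE \<omega> in M. good \<omega>"
  proof eventually_elim
    case (elim \<omega>)
    have "AE t in D. t \<in> {0..T}" by (intro AE_I2) simp
    with elim(7) have "AE t in D. \<xi>2 t \<omega> - \<xi>1 t \<omega> = mean_gap t"
      by eventually_elim (use elim(1,2) in auto)
    moreover have "((\<lambda>s. \<xi>2 s \<omega> - \<xi>1 s \<omega>) \<longlongrightarrow> \<xi>2 t \<omega> - \<xi>1 t \<omega>) (at_right t)" if "t \<in> {0..<T}" for t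
      using elim(3,4) that by (intro tendsto_diff) (auto simp: cadlag_on_def)
    ultimately show ?case unfolding good_def using tendsto_diff[OF elim(6,5)] by blast
  qed
  have "\<exists>\<omega>0. good \<omega>0"
  proof (rule ccontr)
    assume "\<nexists>\<omega>0. good \<omega>0"
    then have "AE \<omega> in M. False" using good by simp
    then show False by simp
  qed
  then obtain \<omega>0 where \<omega>0: "good \<omega>0" by blast
  let ?d = "\<lambda>t. \<xi>2 t \<omega>0 - \<xi>1 t \<omega>0"
  have eq: "\<xi>2 t \<omega> - \<xi>1 t \<omega> = ?d t" if "good \<omega>" "t \<in> {0..T}" for \<omega> t
  proof -
    have below: "\<xi>2 t \<omega> - \<xi>1 t \<omega> = ?d t" if t: "t \<in> {0..<T}" for t
    proof -
      have "AE t in D. (\<xi>2 t \<omega> - \<xi>1 t \<omega>) - ?d t = 0"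
        using \<open>good \<omega>\<close> \<omega>0 unfolding good_def by auto
      then have ae: "AE t in lborel. t \<in> {0..T} \<longrightarrow> (\<xi>2 t \<omega> - \<xi>1 t \<omega>) - ?d t = 0"
        unfolding AE_discounted_time .
      have "((\<lambda>s. (\<xi>2 s \<omega> - \<xi>1 s \<omega>) - ?d s) \<longlongrightarrow> (\<xi>2 t \<omega> - \<xi>1 t \<omega>) - ?d t) (at_right t)"
        using \<open>good \<omega>\<close> \<omega>0 t unfolding good_def by (intro tendsto_diff[of "\<lambda>s. \<xi>2 s \<omega> - \<xi>1 s \<omega>"]) auto
      from right_continuous_AE_zero[OF ae this] t show ?thesis by simp
    qed
    show ?thesis
    proof (cases "t = T")
      case True
      have "\<forall>\<^sub>F s in at_left T. ?d s = \<xi>2 s \<omega> - \<xi>1 s \<omega>"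
        using T_pos below by (intro eventually_at_leftI[of 0 T]) auto
      from Lim_transform_eventually[OF _ this] \<omega>0
      have "((\<lambda>s. \<xi>2 s \<omega> - \<xi>1 s \<omega>) \<longlongrightarrow> ?d T) (at_left T)" unfolding good_def by blast
      moreover have "((\<lambda>s. \<xi>2 s \<omega> - \<xi>1 s \<omega>) \<longlongrightarrow> \<xi>2 T \<omega> - \<xi>1 T \<omega>) (at_left T)"
        using \<open>good \<omega>\<close> unfolding good_def by blast
      ultimately show ?thesis unfolding True by (intro tendsto_unique) auto
    qed (use below[of t] that in auto)
  qed
  have m: "mean_gap t = ?d t" if t: "t \<in> {0..T}" for t
  proof -
    have "AE \<omega> in M. \<xi>2 t \<omega> - \<xi>1 t \<omega> = ?d t"
      using good by eventually_elim (rule eq[OF _ t])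
    from integral_cong_AE_complete[OF _ this] show ?thesis
      \<comment> \<open>The expectation of a constant on a probability space.\<close>
      by (simp add: mean_gap_eq(1)[OF t] prob_space)
  qed
  show "AE \<omega> in M. \<forall>t\<in>{0..T}. \<xi>2 t \<omega> - \<xi>1 t \<omega> = mean_gap t"
    using good by eventually_elim (use eq m in auto)
  show "(mean_gap \<longlongrightarrow> mean_gap t) (at_right t)" if t: "t \<in> {0..<T}" for t
  proof -
    have "\<forall>\<^sub>F s in at_right t. ?d s = mean_gap s"
      using t m by (intro eventually_at_rightI[of t T]) auto
    from Lim_transform_eventually[OF _ this, of "mean_gap t"] show ?thesis
      using \<omega>0 t m[of t] unfolding good_def by auto
  qed
  have "\<forall>\<^sub>F s in at_left T. ?d s = mean_gap s"
    using T_pos m by (intro eventually_at_leftI[of 0 T]) auto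
  from Lim_transform_eventually[OF _ this, of "mean_gap T"]
  show "(mean_gap \<longlongrightarrow> mean_gap T) (at_left T)"
    using \<omega>0 m[OF terminal_time_mem] unfolding good_def by auto
qed

section \<open>Vanishing of the mean gap\<close>

lemma mean_gap_zero_if_not_one:
  assumes "\<alpha> \<noteq> 1" "t \<in> {0..T}"
  shows "mean_gap t = 0"
proof -
  obtain h1 h2 where h1: "version \<xi>1 h1" and h2: "version \<xi>2 h2"
    using ex_version_control controls1 controls2 by blast
  note [measurable] = mean_gap_square_integrable(1)
  have "AE p in P. mean_gap (fst p) = 0"
    using gap_eq_mean_gap_AE[OF h1 h2] by eventually_elim (use assms in simp)
  from P.AE_pair[OF this] have "AE t in D. mean_gap t = 0" by simp
  then have ae: "AE t in lborel. t \<in> {0..T} \<longrightarrow> mean_gap t = 0"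
    unfolding AE_discounted_time .
  have below: "mean_gap t = 0" if "t \<in> {0..<T}" for t
    using right_continuous_AE_zero[OF ae gap_deterministic(2)[OF that]] that by simp
  show ?thesis
  proof (cases "t = T")
    case True
    have "\<forall>\<^sub>F s in at_left T. mean_gap s = 0"
      using T_pos below by (intro eventually_at_leftI[of 0 T]) auto
    then have "(mean_gap \<longlongrightarrow> 0) (at_left T)" by (rule tendsto_eventually)
    with gap_deterministic(3) show ?thesis unfolding True by (intro tendsto_unique) auto
  qed (use below[of t] assms in auto)
qed

text \<open>
  For \<open>\<alpha> = 1\<close> the states centred at their means coincide, so the stationarity conditions of the two
  controls stopped at \<open>b\<close> differ only in the cost of control.
\<close>

lemma mean_gap_volterra:
  assumes \<alpha>: "\<alpha> = 1" and b: "b \<in> {0..T}"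
  shows "exp (- \<rho> * b) * mean_gap b = - \<rho> * (LINT t:{0..b}|lborel. exp (- \<rho> * t) * mean_gap t)"
proof -
  note st1 = stopped_controls[OF controls1 b] and st2 = stopped_controls[OF controls2 b]
  obtain w h1 h2 z1 z2 where w: "version W w" and h1: "version \<xi>1 h1" and h2: "version \<xi>2 h2"
    and z1: "version (stopped b \<xi>1) z1" and z2: "version (stopped b \<xi>2) z2"
    using ex_version_brownian ex_version_control controls1 controls2 st1 st2 by metis
  note s1 = stopped_stationarity[OF sol1 b w h1 z1] and s2 = stopped_stationarity[OF sol2 b w h2 z2]
  have \<beta>: "\<beta> = 1" unfolding \<beta>_def by (simp add: \<alpha>)
  define mb where "mb t = mean_gap (min t b)" for t
  have vz: "version (\<lambda>t \<omega>. stopped b \<xi>2 t \<omega> - stopped b \<xi>1 t \<omega>) (\<lambda>p. z2 p - z1 p)"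
    using version_add[OF z2 z1, of 1 "-1"] by simp
  have mb_mean: "mb t = (\<integral>\<omega>. stopped b \<xi>2 t \<omega> - stopped b \<xi>1 t \<omega> \<partial>M)" if "t \<in> {0..T}" for t
    using mean_gap_eq(1)[of "min t b"] that b
    unfolding mb_def stopped_def by (simp add: min_le_iff_disj)
  have mb: "mb \<in> borel_measurable D" "integrable D (\<lambda>t. (mb t)\<^sup>2)"
    by (rule version_mean[OF vz], erule mb_mean)+
  have vm: "version (\<lambda>t \<omega>. mb t) (\<lambda>p. mb (fst p))" by (rule version_deterministic[OF mb])
  have z_eq: "AE p in P. z2 p - z1 p = mb (fst p)"
  proof (rule version_AE_eq[OF vz vm])
    have "AE t in D. t \<in> {0..T}" by (intro AE_I2) simp
    then show "AE t in D. AE \<omega> in M. stopped b \<xi>2 t \<omega> - stopped b \<xi>1 t \<omega> = mb t"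
    proof eventually_elim
      case (elim t)
      show ?case using gap_deterministic(1)
        by eventually_elim (use elim b in \<open>auto simp: stopped_def mb_def\<close>)
    qed
  qed
  have g1: "version (state \<xi>1) (\<lambda>p. x + \<sigma> * w p - h1 p)" by (rule version_state[OF w h1])
  have \<theta>1: "\<theta>1 \<in> borel_measurable D" "integrable D (\<lambda>t. (\<theta>1 t)\<^sup>2)"
    by (rule version_mean[OF g1], erule solution_mean[OF sol1])+
  define y where "y p = x + \<sigma> * w p - h1 p - \<theta>1 (fst p)" for p
  have vy: "version (\<lambda>t \<omega>. state \<xi>1 t \<omega> - \<theta>1 t) y"
    using version_add[OF g1 version_deterministic[OF \<theta>1], of 1 "-1"] by (simp add: y_def[abs_def])
  have y_mean: "0 = (\<integral>\<omega>. state \<xi>1 t \<omega> - \<theta>1 t \<partial>M)" if t: "t \<in> {0..T}" for t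
  proof -
    have "integrable M (W t)"
      using brownian_moments[OF t] by (auto intro: square_integrable_imp_integrable)
    then have "integrable M (state \<xi>1 t)"
      using controls_square(4)[OF controls1 t] by (simp add: controlled_state_def[abs_def])
    then show ?thesis using solution_mean[OF sol1 t] by (simp add: prob_space)
  qed
  \<comment> \<open>The centred state has mean zero at each time, so it is orthogonal to the
    deterministic stopped gap.\<close>
  have yb: "integrable P (\<lambda>p. mb (fst p) * y p)" "(\<integral>p. mb (fst p) * y p \<partial>P) = 0"
    using integral_mean_mult[OF vy y_mean mb] by simp_all
  have mb_int: "integrable D mb"
    by (rule D.square_integrable_imp_integrable[OF mb])
  then have mb_lift: "integrable P (\<lambda>p. mb (fst p))" "(\<integral>p. mb (fst p) \<partial>P) = integral\<^sup>L D mb"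
    using integral_lift_time[OF mb(1)] by simp_all
  let ?a1 = "\<lambda>p. K * \<rho> * z1 p - (x + \<sigma> * w p - h1 p - \<beta> * \<theta>1 (fst p)) * z1 p"
  let ?a2 = "\<lambda>p. K * \<rho> * z2 p - (x + \<sigma> * w p - h2 p - \<beta> * \<theta>2 (fst p)) * z2 p"
  \<comment> \<open>With \<beta> = 1 the factor multiplying the stopped path is the centred state.
    It is the same \<open>y\<close> for both solutions: passing from the first to the second raises
    the control by the mean gap and lowers the mean by the same amount.\<close>
  have ae: "AE p in P. ?a2 p - ?a1 p = K * \<rho> * mb (fst p) - mb (fst p) * y p"
    using z_eq gap_eq_mean_gap_AE[OF h1 h2]
  proof eventually_elim
    case (elim p)
    have z2p: "z2 p = z1 p + mb (fst p)" using elim(1) by simp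
    have h2p: "h2 p = h1 p + (\<theta>1 (fst p) - \<theta>2 (fst p))" using elim(2) by simp
    show ?case unfolding \<beta> z2p h2p y_def by (simp add: algebra_simps)
  qed
  have "integral\<^sup>L P ?a2 - integral\<^sup>L P ?a1 = (\<integral>p. ?a2 p - ?a1 p \<partial>P)"
    using s1(1) s2(1) by (rule Bochner_Integration.integral_diff[symmetric, rotated])
  also have "\<dots> = (\<integral>p. K * \<rho> * mb (fst p) - mb (fst p) * y p \<partial>P)"
  proof (rule integral_cong_AE[OF _ _ ae])
    show "(\<lambda>p. ?a2 p - ?a1 p) \<in> borel_measurable P"
      by (rule borel_measurable_integrable[OF Bochner_Integration.integrable_diff[OF s2(1) s1(1)]])
    show "(\<lambda>p. K * \<rho> * mb (fst p) - mb (fst p) * y p) \<in> borel_measurable P"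
      using yb(1) mb_lift(1)
      by (intro borel_measurable_integrable Bochner_Integration.integrable_diff integrable_mult_right)
  qed
  also have "\<dots> = K * \<rho> * integral\<^sup>L D mb"
    using yb mb_lift by simp
  finally have diff: "integral\<^sup>L P ?a2 - integral\<^sup>L P ?a1 = K * \<rho> * integral\<^sup>L D mb" .
  have "(integral\<^sup>L P ?a2 - integral\<^sup>L P ?a1)
      + K * exp (- \<rho> * T) * ((\<integral>\<omega>. \<xi>2 b \<omega> \<partial>M) - (\<integral>\<omega>. \<xi>1 b \<omega> \<partial>M)) = 0"
    using s1(2) s2(2) by (simp add: right_diff_distrib)
  then have "K * (\<rho> * integral\<^sup>L D mb + exp (- \<rho> * T) * mean_gap b) = 0"
    unfolding diff mean_gap_eq(2)[OF b, symmetric] by (simp add: algebra_simps)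
  then have 1: "\<rho> * integral\<^sup>L D mb + exp (- \<rho> * T) * mean_gap b = 0"
    using K_pos by simp
  \<comment> \<open>The stopped gap is \<open>u\<close> on [0,b] and constant on [b,T]. The constant
    part contributes the difference of the discounts at \<open>b\<close> and T, which turns the
    terminal discount in equation \<open>1\<close> into the discount at \<open>b\<close>.\<close>
  define u where "u t = indicator {0..b} t * mean_gap t" for t
  note [measurable] = mean_gap_square_integrable(1) mb(1)
  have [measurable]: "(\<lambda>t. t) \<in> borel_measurable D"
    by (simp add: measurable_cong_sets[OF sets_discounted_time refl] measurable_restrict_space1)
  have ind_meas: "(indicator A :: real \<Rightarrow> real) \<in> borel_measurable D" if "A \<in> sets borel" for A
    using that by (simp add: measurable_cong_sets[OF sets_discounted_time refl] measurable_restrict_space1)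
  have u_meas [measurable]: "u \<in> borel_measurable D"
    unfolding u_def[abs_def] using ind_meas by simp
  have tail_int: "integrable D (\<lambda>t. mean_gap b * indicator {b..T} t)"
    using ind_meas[of "{b..T}"] by (intro integrable_mult_right D.integrable_const_bound[where B=1]) auto
  have "AE t in D. t \<in> {0..T}" by (intro AE_I2) simp
  \<comment> \<open>The time \<open>b\<close> is left out because both closed intervals contain it
    and the value there would be counted twice.\<close>
  with AE_time_neq[of b] have u_eq: "AE t in D. u t = mb t - mean_gap b * indicator {b..T} t"
  proof eventually_elim
    case (elim t)
    then show ?case by (cases "t \<le> b") (auto simp: u_def mb_def indicator_def)
  qed
  have "integral\<^sup>L D u = (\<integral>t. mb t - mean_gap b * indicator {b..T} t \<partial>D)"
    using mb_int tail_int
    by (intro integral_cong_AE[OF _ _ u_eq] u_meas borel_measurable_integrable Bochner_Integration.integrable_diff)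
  also have "\<dots> = integral\<^sup>L D mb - mean_gap b * (\<integral>t. indicator {b..T} t \<partial>D)"
    using mb_int tail_int by simp
  finally have u_int: "integral\<^sup>L D u = integral\<^sup>L D mb - mean_gap b * (\<integral>t. indicator {b..T} t \<partial>D)" .
  have "\<rho> * integral\<^sup>L D u = \<rho> * integral\<^sup>L D mb - mean_gap b * (\<rho> * (\<integral>t. indicator {b..T} t \<partial>D))"
    unfolding u_int by algebra
  also have "\<rho> * (\<integral>t. indicator {b..T} t \<partial>D) = exp (- \<rho> * b) - exp (- \<rho> * T)"
    using b by (intro integral_discounted_tail[OF \<rho>_pos]) auto
  \<comment> \<open>Integrated by parts, this says that the discount has zero Stieltjes integral
    against the mean gap over [0,b], jump at 0 included.\<close>
  finally have 2: "exp (- \<rho> * b) * mean_gap b = - \<rho> * integral\<^sup>L D u"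
    using 1 by (simp add: algebra_simps)
  have "u \<in> borel_measurable (restrict_space borel {0..T})"
    using u_meas by (simp add: measurable_cong_sets[OF sets_discounted_time refl])
  then have "integral\<^sup>L D u = (LINT t:{0..T}|lborel. exp (- \<rho> * t) * u t)"
    by (rule integral_discounted_time[symmetric])
  also have "\<dots> = (LINT t:{0..b}|lborel. exp (- \<rho> * t) * mean_gap t)"
    unfolding set_lebesgue_integral_def
    using b by (intro Bochner_Integration.integral_cong) (auto simp: u_def indicator_def)
  finally show ?thesis using 2 by simp
qed

lemma mean_gap_zero:
  assumes "t \<in> {0..T}" shows "mean_gap t = 0"
proof (cases "\<alpha> = 1")
  case True
  have "integrable D mean_gap"
    by (rule D.square_integrable_imp_integrable[OF mean_gap_square_integrable])
  then have int: "set_integrable lborel {0..T} (\<lambda>t. exp (- \<rho> * t) * mean_gap t)"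
    by (rule integrable_discounted_time)
  \<comment> \<open>The unknown of the integral equation is the discounted gap.\<close>
  have "exp (- \<rho> * t) * mean_gap t = 0"
    by (rule linear_integral_equation_zero[OF int _ assms]) (rule mean_gap_volterra[OF True])
  then show ?thesis by simp
qed (rule mean_gap_zero_if_not_one[OF _ assms])

end

theorem corollary4p9:
  fixes M :: "'a measure" and F :: "real \<Rightarrow> 'a measure" and W :: "real \<Rightarrow> 'a \<Rightarrow> real"
    and T \<sigma> \<rho> K \<alpha> x :: real
    and \<xi>1 \<xi>2 :: "real \<Rightarrow> 'a \<Rightarrow> real" and \<theta>1 \<theta>2 :: "real \<Rightarrow> real"
  assumes "T > 0" and "\<sigma> > 0" and "\<rho> > 0" and "K > 0"
    and "brownian_filtered_space M F T W"
    and "mfg_solution M F T W \<sigma> \<rho> K \<alpha> x \<xi>1 \<theta>1"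
    and "mfg_solution M F T W \<sigma> \<rho> K \<alpha> x \<xi>2 \<theta>2"
  shows "(AE \<omega> in M. \<forall>t\<in>{0..T}. \<xi>1 t \<omega> = \<xi>2 t \<omega>) \<and> (\<forall>t\<in>{0..T}. \<theta>1 t = \<theta>2 t)"
proof -
  interpret brownian_filtered_space M F T W by fact
  interpret two_solutions M F T W \<sigma> \<rho> K \<alpha> x \<xi>1 \<xi>2 \<theta>1 \<theta>2
    by unfold_locales (use assms in auto)
  have "AE \<omega> in M. \<forall>t\<in>{0..T}. \<xi>1 t \<omega> = \<xi>2 t \<omega>"
    using gap_deterministic(1) by eventually_elim (use mean_gap_zero in auto)
  then show ?thesis using mean_gap_zero by auto
qed

end
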